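(* Fix a Dirichlet series $f \in \mathcal{D}_0$ and $w\in \mathbb{C}$. (i) The equation $f(s-w g(s))=g(s)$ has a unique solution $g \in \mathcal{D}_0$. (ii) Let $\alpha_n(x)$ be the family of Dirichlet convolution polynomials generated by $f$ via $$e^{x f(s)}=\sum_{n\ge 1} \frac{\alpha_n(x)}{n^s}.$$ Then the solution to the equation $f(s-wg(s))=g(s)$ is given by $$g(s)=\sum_{n\ge 2} \frac{\hat \alpha_n(w\ln(n))}{n^s}$$ and it satisfies $$e^{x g(s)}=1+x\sum_{n\ge 2} \frac{\hat \alpha_n(x+w\ln(n))}{n^s}, \qquad x\in \mathbb{C}.$$ The Dirichlet series in the last two displays converge absolutely in some half-plane $\mathbb{C}_{\theta}$.
   Context: For $\theta\in\mathbb{R}$, $\mathbb{C}_\theta:=\{z\in\mathbb{C}: \mathrm{Re}(z)>\theta\}$. $\mathcal{D}$ denotes the set of Dirichlet series $\sum_{n\ge1} c_n n^{-s}$ that converge absolutely in some half-plane $\mathbb{C}_\theta$, and $\mathcal{D}_0$ the set of those series in $\mathcal{D}$ with zero constant term ($c_1=0$). Dirichlet convolution polynomials are polynomials $\{\alpha_n(x)\}_{n\ge1}$ satisfying $\alpha_n(x+y)=\sum_{d\mid n}\alpha_d(x)\alpha_{n/d}(y)$ for all $n\ge1$; for such polynomials $\alpha_1\equiv1$ and $\alpha_n(0)=0$ for $n\ge2$, and the hat-operation is $\hat\alpha_n(x):=x^{-1}\alpha_n(x)$ for $n\ge 2$ (a polynomial). *)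

theory Defs
  imports "HOL-Analysis.Analysis" "HOL-Computational_Algebra.Polynomial"
begin

definition half_plane :: "real \<Rightarrow> complex set" where
  "half_plane \<theta> = {z. Re z > \<theta>}"

text \<open>
  A Dirichlet series is represented by its sequence of coefficients
  \<open>c :: nat \<Rightarrow> complex\<close>; the relevant indices are \<open>n \<ge> 1\<close>.
\<close>

definition ds_abs_conv :: "(nat \<Rightarrow> complex) \<Rightarrow> complex \<Rightarrow> bool" where
  "ds_abs_conv c s \<longleftrightarrow> (\<lambda>n. norm (c n / of_nat n powr s)) summable_on {1..}"

definition ds_eval :: "(nat \<Rightarrow> complex) \<Rightarrow> complex \<Rightarrow> complex" where
  "ds_eval c s = (\<Sum>\<^sub>\<infinity>n\<in>{1..}. c n / of_nat n powr s)"

text \<open>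
  The condition \<open>c 0 = 0\<close> only fixes the value at the unused index \<open>0\<close>, so that a
  Dirichlet series corresponds to exactly one coefficient sequence.
\<close>

definition dirichlet_D :: "(nat \<Rightarrow> complex) set" where
  "dirichlet_D = {c. c 0 = 0 \<and> (\<exists>\<theta>. \<forall>s\<in>half_plane \<theta>. ds_abs_conv c s)}"

definition dirichlet_D0 :: "(nat \<Rightarrow> complex) set" where
  "dirichlet_D0 = {c \<in> dirichlet_D. c 1 = 0}"

text \<open>
  Identities between Dirichlet series are understood on some half-plane. The equation
  \<open>f (s - w g(s)) = g s\<close> includes the requirement that both series involved converge
  absolutely at the points where they are evaluated.
\<close>

definition solves_ds_equation :: "(nat \<Rightarrow> complex) \<Rightarrow> complex \<Rightarrow> (nat \<Rightarrow> complex) \<Rightarrow> bool" where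
  "solves_ds_equation f w g \<longleftrightarrow>
     (\<exists>\<theta>. \<forall>s\<in>half_plane \<theta>.
        ds_abs_conv g s \<and>
        ds_abs_conv f (s - w * ds_eval g s) \<and>
        ds_eval f (s - w * ds_eval g s) = ds_eval g s)"

definition dirichlet_convolution_polys :: "(nat \<Rightarrow> complex poly) \<Rightarrow> bool" where
  "dirichlet_convolution_polys \<alpha> \<longleftrightarrow>
     (\<forall>n\<ge>1. \<forall>x y. poly (\<alpha> n) (x + y) =
        (\<Sum>d | d dvd n. poly (\<alpha> d) x * poly (\<alpha> (n div d)) y))"

definition generated_by :: "(nat \<Rightarrow> complex poly) \<Rightarrow> (nat \<Rightarrow> complex) \<Rightarrow> bool" where
  "generated_by \<alpha> f \<longleftrightarrow>
     (\<forall>x. \<exists>\<theta>. \<forall>s\<in>half_plane \<theta>.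
        ds_abs_conv (\<lambda>n. poly (\<alpha> n) x) s \<and>
        exp (x * ds_eval f s) = ds_eval (\<lambda>n. poly (\<alpha> n) x) s)"

text \<open>
  Division by the indeterminate is polynomial division, so that the result is a polynomial
  and also has the right value at \<open>0\<close>; it is exact whenever \<open>p\<close> vanishes at \<open>0\<close>.
\<close>

definition hat_poly :: "complex poly \<Rightarrow> complex poly" where
  "hat_poly p = p div [:0, 1:]"

lemma poly_hat_poly:
  assumes "poly p 0 = 0"
  shows "x * poly (hat_poly p) x = poly p x"
proof -
  have "[:0, 1:] dvd p"
    using assms poly_eq_0_iff_dvd[of p 0] by simp
  then have "p = [:0, 1:] * hat_poly p"
    unfolding hat_poly_def by (rule dvd_mult_div_cancel [symmetric])
  then have "poly p x = poly ([:0, 1:] * hat_poly p) x"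
    by (rule arg_cong)
  then show ?thesis by simp
qed

end

(* The unique candidate is read off from the Lagrange-type formula, so put
   b_1(x) = 1 and b_n(x) = x * hat(alpha_n)(x + w ln n) for n >= 2.  Differentiating exp (x f(s))
   in x and in s gives two convolution recursions for alpha_n; together they yield
     b_n'(x) = sum over d | n of f_d b_(n/d)(x + w ln d).
   By induction on n this implies b_n' = sum over d | n of b_d'(0) b_(n/d), so the b_n(x) are the
   coefficients of exp (x g(s)), where g has coefficients g_n = b_n'(0) = hat(alpha_n)(w ln n).
   At x = 0 the displayed recursion is the equation f(s - w g(s)) = g(s), compared coefficientwise.
   Uniqueness holds since f is a contraction, as strong as desired, far to the right. *)

theory Submission
  imports Defs
begin

section \<open>Absolutely convergent Dirichlet series\<close>

text \<open>A vanishing constant term makes the convolution recursions triangular: the term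
  \<open>d = 1\<close> drops out and only indices \<open>n div d < n\<close> remain. It also gives
  exponentials polynomial coefficients, which can be treated exactly before any question of
  convergence. Additivity of \<open>ln\<close> makes the shifts compatible with convolution: x + w
  ln d + w ln (n/d) = x + w ln n for every divisor d. Exponentials of g enter the equation because
  d^(-(s - w g(s))) = d^(-s) exp (w ln d g(s)); composing with f therefore evaluates the coefficient
  polynomials of exp (x g(s)) at x = w ln d. Convergence is controlled by a weighted l1 norm. It is
  submultiplicative, so exponentials are bounded by exponentials of norms, and at x = w ln d such a
  bound is just a power of d. Composition and the Lagrange series thus cost only a shift of the
  half-plane.\<close>

lemma norm_ds_term:
  "n \<ge> 1 \<Longrightarrow> norm (c / of_nat n powr s) = norm c / real n powr Re s"
  using norm_powr_real_powr[of "of_nat n" s] by (simp add: norm_divide)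

lemma ds_term_mult:
  "of_nat (m * n) powr (s::complex) = of_nat m powr s * of_nat n powr s"
  using powr_times_real[of "of_nat m" "of_nat n" s] by simp

text \<open>The weighted l1 norm that makes Dirichlet series a Banach algebra under convolution.
  Where the sum diverges \<open>infsum\<close> returns 0, so the estimates below assume
  \<open>ds_abs_conv\<close>.\<close>

definition ds_norm :: "(nat \<Rightarrow> complex) \<Rightarrow> real \<Rightarrow> real" where
  "ds_norm c \<sigma> = (\<Sum>\<^sub>\<infinity>n\<in>{1..}. norm (c n) / real n powr \<sigma>)"

lemma ds_abs_conv_iff:
  "ds_abs_conv c s \<longleftrightarrow> (\<lambda>n. norm (c n) / real n powr Re s) summable_on {1..}"
  unfolding ds_abs_conv_def by (intro summable_on_cong norm_ds_term) simp

lemma ds_norm_eq: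
  "ds_norm c (Re s) = (\<Sum>\<^sub>\<infinity>n\<in>{1..}. norm (c n / of_nat n powr s))"
  unfolding ds_norm_def by (intro infsum_cong norm_ds_term[symmetric]) simp

lemma ds_abs_conv_summable:
  "ds_abs_conv c s \<Longrightarrow> (\<lambda>n. c n / of_nat n powr s) summable_on {1..}"
  unfolding ds_abs_conv_def by (rule abs_summable_summable)

lemma ds_norm_nonneg: "ds_norm c \<sigma> \<ge> 0"
  unfolding ds_norm_def by (intro infsum_nonneg) simp

lemma norm_ds_eval_le: "ds_abs_conv c s \<Longrightarrow> norm (ds_eval c s) \<le> ds_norm c (Re s)"
  unfolding ds_eval_def ds_norm_eq ds_abs_conv_def by (rule norm_infsum_bound)

lemma ds_abs_conv_mono:
  assumes "ds_abs_conv c s" "Re s \<le> Re t"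
  shows "ds_abs_conv c t"
  unfolding ds_abs_conv_iff
proof (rule summable_on_comparison_test)
  show "(\<lambda>n. norm (c n) / real n powr Re s) summable_on {1..}"
    using assms(1) by (simp add: ds_abs_conv_iff)
  show "norm (c n) / real n powr Re t \<le> norm (c n) / real n powr Re s" if "n \<in> {1..}" for n
    using that assms(2) by (intro divide_left_mono powr_mono) auto
qed simp

lemma coeff_bound:
  assumes "ds_abs_conv c s" "n \<ge> 1"
  shows "norm (c n) \<le> ds_norm c (Re s) * real n powr Re s"
proof -
  have "(\<Sum>k\<in>{n}. norm (c k) / real k powr Re s) \<le> ds_norm c (Re s)"
    unfolding ds_norm_def using assms by (intro finite_sum_le_infsum) (auto simp: ds_abs_conv_iff)
  then show ?thesis using assms(2) by (simp add: field_simps)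
qed

text \<open>For n >= m the extra factor n^(-t) is at most m^(-t). The case m = 1 gives monotonicity,
  m = 2 smallness far to the right, and m + 1 the decay of a tail.\<close>

lemma ds_norm_shift_le:
  assumes "ds_abs_conv c s" "\<And>n. 1 \<le> n \<Longrightarrow> n < m \<Longrightarrow> c n = 0" "m \<ge> 1" "t \<ge> 0"
  shows "ds_norm c (Re s + t) \<le> ds_norm c (Re s) / real m powr t"
proof -
  have "ds_norm c (Re s + t) \<le> (\<Sum>\<^sub>\<infinity>n\<in>{1..}. norm (c n) / real n powr Re s * inverse (real m powr t))"
    unfolding ds_norm_def
  proof (rule infsum_mono)
    show "(\<lambda>n. norm (c n) / real n powr (Re s + t)) summable_on {1..}"
      using ds_abs_conv_mono[OF assms(1), of "s + of_real t"] assms(4) by (simp add: ds_abs_conv_iff)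
    show "(\<lambda>n. norm (c n) / real n powr Re s * inverse (real m powr t)) summable_on {1..}"
      using assms(1) by (intro summable_on_cmult_left) (simp add: ds_abs_conv_iff)
    fix n :: nat assume n: "n \<in> {1..}"
    show "norm (c n) / real n powr (Re s + t) \<le> norm (c n) / real n powr Re s * inverse (real m powr t)"
    proof (cases "n < m")
      case True
      then show ?thesis using assms(2) n by simp
    next
      case False
      then have "real m powr t \<le> real n powr t" using assms(3,4) by (intro powr_mono2) auto
      then have "norm (c n) / real n powr Re s * inverse (real n powr t)
          \<le> norm (c n) / real n powr Re s * inverse (real m powr t)"
        using assms(3) by (intro mult_left_mono le_imp_inverse_le) auto
      then show ?thesis by (simp add: powr_add field_simps)
    qed
  qed
  also have "\<dots> = ds_norm c (Re s) / real m powr t"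
    unfolding ds_norm_def by (subst infsum_cmult_left') (simp add: divide_inverse)
  finally show ?thesis .
qed

text \<open>A converse to \<open>coeff_bound\<close> that loses 1 in the abscissa, by comparison
  with the series of n^(b - Re s).\<close>

lemma polynomial_growth_abs_conv:
  assumes "\<And>n. n \<ge> 1 \<Longrightarrow> norm (c n) \<le> C * real n powr b" "Re s > b + 1"
  shows "ds_abs_conv c s"
  unfolding ds_abs_conv_iff
proof (rule summable_on_comparison_test)
  have "summable (\<lambda>n. real n powr (b - Re s))" using assms(2) by (simp add: summable_real_powr_iff)
  then have "(\<lambda>n. real n powr (b - Re s)) summable_on UNIV"
    by (intro summable_nonneg_imp_summable_on) auto
  then have "(\<lambda>n. real n powr (b - Re s)) summable_on {1..}"
    by (rule summable_on_subset_banach) simp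
  then show "(\<lambda>n. C * real n powr (b - Re s)) summable_on {1..}"
    by (rule summable_on_cmult_right)
  show "norm (c n) / real n powr Re s \<le> C * real n powr (b - Re s)" if "n \<in> {1..}" for n
  proof -
    have "norm (c n) / real n powr Re s \<le> C * real n powr b / real n powr Re s"
      using assms(1)[of n] that by (intro divide_right_mono) auto
    then show ?thesis by (simp add: powr_diff)
  qed
qed simp

text \<open>A closed half-plane, so that its boundary point \<open>of_real \<sigma>\<close> can
  serve as base point for norms.\<close>

lemma dirichlet_D0_abs_conv:
  assumes "c \<in> dirichlet_D0"
  obtains \<sigma> where "\<And>s. Re s \<ge> \<sigma> \<Longrightarrow> ds_abs_conv c s"
proof -
  from assms obtain \<theta> where "\<forall>s\<in>half_plane \<theta>. ds_abs_conv c s"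
    by (auto simp: dirichlet_D0_def dirichlet_D_def)
  then show ?thesis by (intro that[of "\<theta> + 1"]) (auto simp: half_plane_def)
qed

lemma ds_eval_diff:
  assumes "ds_abs_conv a s" "ds_abs_conv b s"
  shows "ds_abs_conv (\<lambda>n. a n - b n) s" "ds_eval (\<lambda>n. a n - b n) s = ds_eval a s - ds_eval b s"
proof -
  have "(\<lambda>n. norm (a n / of_nat n powr s) + norm (b n / of_nat n powr s)) summable_on {1..}"
    using assms by (intro summable_on_add) (auto simp: ds_abs_conv_def)
  then show "ds_abs_conv (\<lambda>n. a n - b n) s"
    unfolding ds_abs_conv_def
    by (rule summable_on_comparison_test) (auto simp: diff_divide_distrib norm_triangle_ineq4)
  have "ds_eval (\<lambda>n. a n - b n) s = (\<Sum>\<^sub>\<infinity>n\<in>{1..}. a n / of_nat n powr s + - (b n / of_nat n powr s))"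
    by (simp add: ds_eval_def diff_divide_distrib)
  also have "\<dots> = ds_eval a s - ds_eval b s"
    using assms[THEN ds_abs_conv_summable]
    by (subst infsum_add) (auto simp: summable_on_uminus infsum_uminus ds_eval_def)
  finally show "ds_eval (\<lambda>n. a n - b n) s = ds_eval a s - ds_eval b s" .
qed

text \<open>If all coefficients before m vanish, the m-th term equals minus the tail. Moving right
  by t, the tail decays like (m+1)^(-t) and the term only like m^(-t), so the m-th coefficient is
  O((m/(m+1))^t).\<close>

lemma ds_coeffs_zero:
  assumes "\<And>s. Re s \<ge> \<sigma> \<Longrightarrow> ds_abs_conv c s" "\<And>s. Re s \<ge> \<sigma> \<Longrightarrow> ds_eval c s = 0" "n \<ge> 1"
  shows "c n = 0"
  using assms(3)
proof (induction n rule: less_induct)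
  case (less m)
  define e where "e n = (if n \<le> m then 0 else c n)" for n
  define K where "K = real m / real (Suc m)"
  have K: "0 < K" "K < 1" using less.prems by (auto simp: K_def)
  have conv: "ds_abs_conv e s" if "Re s \<ge> \<sigma>" for s
    using assms(1)[OF that] unfolding ds_abs_conv_def
    by (rule summable_on_comparison_test) (auto simp: e_def)
  have bound: "norm (c m) \<le> real m powr \<sigma> * ds_norm e \<sigma> * K powr t" if t: "t \<ge> 0" for t
  proof -
    define s :: complex where "s = of_real (\<sigma> + t)"
    have s: "Re s = \<sigma> + t" "Re s \<ge> \<sigma>" using t by (auto simp: s_def)
    have "0 = ds_eval c s" using assms(2) s by simp
    also have "\<dots> = (\<Sum>\<^sub>\<infinity>n\<in>insert m ({1..} - {m}). c n / of_nat n powr s)"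
      using less.prems by (simp add: ds_eval_def insert_absorb)
    also have "\<dots> = c m / of_nat m powr s + (\<Sum>\<^sub>\<infinity>n\<in>{1..} - {m}. c n / of_nat n powr s)"
      using ds_abs_conv_summable[OF assms(1)[OF s(2)]]
      by (intro infsum_insert) (auto intro: summable_on_subset_banach)
    \<comment> \<open>The terms below \<open>m\<close> vanish by the induction hypothesis, which
      leaves the tail \<open>e\<close>.\<close>
    also have "(\<Sum>\<^sub>\<infinity>n\<in>{1..} - {m}. c n / of_nat n powr s) = ds_eval e s"
      unfolding ds_eval_def using less
      by (intro infsum_cong_neutral) (auto simp: e_def)
    finally have "norm (c m / of_nat m powr s) = norm (ds_eval e s)"
      by (metis add.commute add_eq_0_iff norm_minus_cancel)
    also have "\<dots> \<le> ds_norm e (\<sigma> + t)" using norm_ds_eval_le[OF conv[OF s(2)]] s by simp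
    also have "\<dots> \<le> ds_norm e \<sigma> / real (Suc m) powr t"
      using ds_norm_shift_le[OF conv, of "of_real \<sigma>" "Suc m" t] t by (simp add: e_def)
    finally have "norm (c m) \<le> ds_norm e \<sigma> / real (Suc m) powr t * real m powr (\<sigma> + t)"
      using less.prems s by (subst (asm) norm_ds_term) (auto simp: field_simps)
    also have "\<dots> = real m powr \<sigma> * ds_norm e \<sigma> * K powr t"
      by (simp add: K_def powr_add powr_divide)
    finally show ?thesis .
  qed
  have "((\<lambda>t. K powr t) \<longlongrightarrow> 0) at_top"
  proof -
    have "((\<lambda>t. exp (- (t * - ln K))) \<longlongrightarrow> 0) at_top"
      using K by (intro filterlim_compose[OF exp_at_bot] filterlim_compose[OF filterlim_uminus_at_bot_at_top]
          filterlim_at_top_mult_tendsto_pos[OF tendsto_const] filterlim_ident) auto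
    then show ?thesis using K by (simp add: powr_def)
  qed
  then have "((\<lambda>t. real m powr \<sigma> * ds_norm e \<sigma> * K powr t) \<longlongrightarrow> 0) at_top"
    by (rule tendsto_mult_right_zero)
  moreover have "\<forall>\<^sub>F t in at_top. norm (c m) \<le> real m powr \<sigma> * ds_norm e \<sigma> * K powr t"
    using eventually_ge_at_top[of 0] by eventually_elim (rule bound)
  ultimately have "norm (c m) \<le> 0"
    by (intro tendsto_le[OF _ _ tendsto_const]) auto
  then show ?case by simp
qed

lemma ds_coeffs_unique:
  assumes "\<And>s. Re s \<ge> \<sigma> \<Longrightarrow> ds_abs_conv a s" "\<And>s. Re s \<ge> \<sigma> \<Longrightarrow> ds_abs_conv b s"
    "\<And>s. Re s \<ge> \<sigma> \<Longrightarrow> ds_eval a s = ds_eval b s" "n \<ge> 1"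
  shows "a n = b n"
  using ds_coeffs_zero[of \<sigma> "\<lambda>n. a n - b n" n] assms by (auto simp: ds_eval_diff)

section \<open>Double series and products\<close>

text \<open>The Fubini criterion behind all three rearrangements: products, exponentials and
  composition.\<close>

lemma abs_summable_on_Times:
  fixes h :: "'a \<Rightarrow> 'b \<Rightarrow> complex"
  assumes "\<And>a. a \<in> A \<Longrightarrow> (\<lambda>b. norm (h a b)) summable_on B"
    and "M summable_on A" "\<And>a. a \<in> A \<Longrightarrow> (\<Sum>\<^sub>\<infinity>b\<in>B. norm (h a b)) \<le> M a"
  shows "(\<lambda>x. norm (case x of (a, b) \<Rightarrow> h a b)) summable_on (A \<times> B)"
proof -
  have "(\<lambda>a. \<Sum>\<^sub>\<infinity>b\<in>B. norm (h a b)) summable_on A"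
    by (rule summable_on_comparison_test[OF assms(2,3)]) (auto intro: infsum_nonneg)
  then have "(\<lambda>a. norm (\<Sum>\<^sub>\<infinity>b\<in>B. norm (h a b))) summable_on A"
    by (rule summable_on_iff_abs_summable_on_real[THEN iffD1])
  with assms(1) have "(\<forall>a\<in>A. (\<lambda>b. norm (case (a, b) of (a, b) \<Rightarrow> h a b)) summable_on B)
      \<and> (\<lambda>a. norm (\<Sum>\<^sub>\<infinity>b\<in>B. norm (case (a, b) of (a, b) \<Rightarrow> h a b))) summable_on A"
    unfolding split by blast
  then show ?thesis by (rule Infinite_Sum.abs_summable_on_Sigma_iff[THEN iffD2])
qed

lemma bij_betw_divisor_pairs:
  "bij_betw (\<lambda>(n, d). (d, n div d)) (SIGMA n:{1..}. {d. d dvd n}) ({1..} \<times> {1::nat..})"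
  by (rule bij_betwI[where g = "\<lambda>(a, b). (a * b, a)"])
    (auto simp: Suc_le_eq dvd_div_eq_0_iff dest: dvd_pos_nat intro!: Nat.gr0I)

lemma infsum_by_divisors:
  fixes h :: "nat \<Rightarrow> nat \<Rightarrow> 'a :: banach"
  assumes "(\<lambda>(a, b). h a b) summable_on ({1..} \<times> {1..})"
  shows "(\<lambda>n. \<Sum>d | d dvd n. h d (n div d)) summable_on {1..}"
    and "(\<Sum>\<^sub>\<infinity>n\<in>{1..}. \<Sum>d | d dvd n. h d (n div d)) = (\<Sum>\<^sub>\<infinity>a\<in>{1..}. \<Sum>\<^sub>\<infinity>b\<in>{1..}. h a b)"
proof -
  let ?D = "SIGMA n:{1::nat..}. {d. d dvd n}"
  have eq: "infsum (\<lambda>d. h d (n div d)) {d. d dvd n} = (\<Sum>d | d dvd n. h d (n div d))"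
    if "n \<in> {1..}" for n using that by (intro infsum_finite) auto
  have S: "(\<lambda>(n, d). h d (n div d)) summable_on ?D"
    using assms summable_on_reindex_bij_betw[OF bij_betw_divisor_pairs, of "\<lambda>(a, b). h a b"]
    by (simp add: case_prod_unfold)
  show "(\<lambda>n. \<Sum>d | d dvd n. h d (n div d)) summable_on {1..}"
    using summable_on_Sigma_banach[OF S] by (rule summable_on_cong[THEN iffD1, rotated]) (rule eq)
  have "(\<Sum>\<^sub>\<infinity>n\<in>{1..}. \<Sum>d | d dvd n. h d (n div d)) = infsum (\<lambda>(n, d). h d (n div d)) ?D"
    by (subst infsum_Sigma'_banach[OF S, symmetric]) (intro infsum_cong eq[symmetric])
  also have "\<dots> = infsum (\<lambda>(a, b). h a b) ({1..} \<times> {1..})"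
    using infsum_reindex_bij_betw[OF bij_betw_divisor_pairs, of "\<lambda>(a, b). h a b"]
    by (simp add: case_prod_unfold)
  also have "\<dots> = (\<Sum>\<^sub>\<infinity>a\<in>{1..}. \<Sum>\<^sub>\<infinity>b\<in>{1..}. h a b)"
    by (rule infsum_Sigma'_banach[symmetric, OF assms])
  finally show "(\<Sum>\<^sub>\<infinity>n\<in>{1..}. \<Sum>d | d dvd n. h d (n div d)) = (\<Sum>\<^sub>\<infinity>a\<in>{1..}. \<Sum>\<^sub>\<infinity>b\<in>{1..}. h a b)" .
qed

definition dconv :: "(nat \<Rightarrow> complex) \<Rightarrow> (nat \<Rightarrow> complex) \<Rightarrow> nat \<Rightarrow> complex" where
  "dconv a b n = (\<Sum>d | d dvd n. a d * b (n div d))"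

lemma dconv_term:
  "(\<Sum>d | d dvd n. a d / of_nat d powr s * (b (n div d) / of_nat (n div d) powr s))
    = dconv a b n / of_nat n powr (s::complex)"
proof -
  have "a d / of_nat d powr s * (b (n div d) / of_nat (n div d) powr s)
      = a d * b (n div d) / of_nat n powr s" if "d dvd n" for d
    using that ds_term_mult[of d "n div d" s] by simp
  then show ?thesis unfolding dconv_def sum_divide_distrib by (intro sum.cong) auto
qed

text \<open>The double series of products is regrouped along a b = n: for the terms themselves this
  gives the value, for their norms the convergence and the norm bound.\<close>

lemma
  assumes "ds_abs_conv a s" "ds_abs_conv b s"
  shows ds_abs_conv_dconv: "ds_abs_conv (dconv a b) s"
    and ds_eval_dconv: "ds_eval (dconv a b) s = ds_eval a s * ds_eval b s"
    and ds_norm_dconv: "ds_norm (dconv a b) (Re s) \<le> ds_norm a (Re s) * ds_norm b (Re s)"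
proof -
  define u where "u n = a n / of_nat n powr s" for n
  define v where "v n = b n / of_nat n powr s" for n
  have uv: "(\<lambda>n. norm (u n)) summable_on {1..}" "(\<lambda>n. norm (v n)) summable_on {1..}"
    using assms by (simp_all add: ds_abs_conv_def u_def v_def)
  have S: "(\<lambda>x. norm (case x of (i, j) \<Rightarrow> u i * v j)) summable_on ({1..} \<times> {1..})"
    using uv by (intro abs_summable_on_Times[where M = "\<lambda>i. norm (u i) * (\<Sum>\<^sub>\<infinity>j\<in>{1..}. norm (v j))"])
      (auto simp: norm_mult infsum_cmult_right' intro!: summable_on_cmult_right summable_on_cmult_left)
  then have S': "(\<lambda>(i, j). norm (u i * v j)) summable_on ({1..} \<times> {1..})"
    by (simp add: case_prod_unfold)
  have uv_term: "dconv a b n / of_nat n powr s = (\<Sum>d | d dvd n. u d * v (n div d))" for n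
    by (simp add: u_def v_def flip: dconv_term)
  note D = infsum_by_divisors[OF S']
  have le: "norm (dconv a b n / of_nat n powr s) \<le> (\<Sum>d | d dvd n. norm (u d * v (n div d)))" for n
    unfolding uv_term by (rule norm_sum)
  show conv: "ds_abs_conv (dconv a b) s"
    unfolding ds_abs_conv_def by (rule summable_on_comparison_test[OF D(1) le]) simp
  show "ds_eval (dconv a b) s = ds_eval a s * ds_eval b s"
    using infsum_by_divisors(2)[OF abs_summable_summable[OF S]] unfolding ds_eval_def
    by (simp add: uv_term infsum_cmult_right' infsum_cmult_left' flip: u_def v_def)
  have "ds_norm (dconv a b) (Re s) \<le> (\<Sum>\<^sub>\<infinity>n\<in>{1..}. \<Sum>d | d dvd n. norm (u d * v (n div d)))"
    unfolding ds_norm_eq using conv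
    by (intro infsum_mono[OF _ D(1) le]) (auto simp: ds_abs_conv_def)
  then show "ds_norm (dconv a b) (Re s) \<le> ds_norm a (Re s) * ds_norm b (Re s)"
    using D(2) by (simp add: ds_norm_eq norm_mult infsum_cmult_right' infsum_cmult_left' flip: u_def v_def)
qed

section \<open>The polynomials generated by a Dirichlet series\<close>

lemma codivisor_ge_1: "d dvd n \<Longrightarrow> n \<ge> 1 \<Longrightarrow> 1 \<le> n div (d::nat)"
  by (auto simp: Suc_le_eq dvd_div_eq_0_iff intro!: Nat.gr0I)

lemma codivisor_less: "d dvd n \<Longrightarrow> n \<ge> 1 \<Longrightarrow> d \<noteq> 1 \<Longrightarrow> n div d < (n::nat)"
  by (intro div_less_dividend) (auto simp: less_Suc_eq dest: dvd_pos_nat intro: Nat.gr0I)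

lemma poly_ext:
  fixes p q :: "complex poly"
  assumes "\<And>x. poly p x = poly q x"
  shows "p = q"
  using assms by (simp add: poly_eq_poly_eq_iff[symmetric] fun_eq_iff)

lemma pderiv_sum: "pderiv (\<Sum>x\<in>A. p x) = (\<Sum>x\<in>A. pderiv (p x))"
  using higher_pderiv_sum[of 1 p A] by simp

lemma smult_sum_right: "smult a (\<Sum>x\<in>A. p x) = (\<Sum>x\<in>A. smult a (p x))"
  by (induction A rule: infinite_finite_induct) (simp_all add: smult_add_right)

primrec cpow :: "(nat \<Rightarrow> complex) \<Rightarrow> nat \<Rightarrow> nat \<Rightarrow> complex" where
  "cpow c 0 = (\<lambda>n. if n = 1 then 1 else 0)"
| "cpow c (Suc k) = dconv c (cpow c k)"

text \<open>A nonzero coefficient at n needs a product of k factors, each at least 2, hence n >= 2^k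
  > k. The crude consequence k < n is all that is used.\<close>

lemma cpow_eq_0:
  assumes "c 1 = 0" "1 \<le> n" "n \<le> k"
  shows "cpow c k n = 0"
  using assms(2,3)
proof (induction k arbitrary: n)
  case (Suc k)
  have "c d * cpow c k (n div d) = 0" if "d dvd n" for d
  proof (cases "d = 1")
    case False
    with that Suc.prems have "1 \<le> n div d" "n div d < n"
      using codivisor_ge_1[of d n] codivisor_less[of d n] by auto
    then show ?thesis using Suc.IH[of "n div d"] Suc.prems by simp
  qed (use assms(1) in simp)
  then show ?case unfolding cpow.simps dconv_def by (intro sum.neutral) blast
qed simp

text \<open>Truncating the exponential series at \<open>k = n\<close> loses nothing when \<open>c 1 = 0\<close>.\<close>

definition dexp_poly :: "(nat \<Rightarrow> complex) \<Rightarrow> nat \<Rightarrow> complex poly" where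
  "dexp_poly c n = (\<Sum>k\<le>n. monom (cpow c k n / fact k) k)"

text \<open>Any cut-off beyond \<open>n\<close> gives the same value, so the sums for all proper
  codivisors can be cut at one common index and exchanged with a divisor sum.\<close>

lemma poly_dexp_poly:
  assumes "c 1 = 0" "1 \<le> n" "n < N"
  shows "poly (dexp_poly c n) x = (\<Sum>k<N. cpow c k n / fact k * x ^ k)"
  unfolding dexp_poly_def poly_sum poly_monom
  by (rule sum.mono_neutral_left) (use assms cpow_eq_0[of c n] in auto)

lemma dexp_poly_1: "c 1 = 0 \<Longrightarrow> dexp_poly c 1 = 1"
  by (simp add: dexp_poly_def dconv_def one_pCons monom_0)

lemma poly_dexp_poly_0: "n \<noteq> 1 \<Longrightarrow> poly (dexp_poly c n) 0 = 0"
  by (auto simp: dexp_poly_def poly_sum poly_monom power_0_left intro!: sum.neutral)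

lemma of_nat_mult_div_fact_Suc:
  "of_nat (Suc k) * (a / fact (Suc k)) = (a / fact k :: complex)"
  by (simp add: field_simps del: of_nat_Suc)

text \<open>The coefficients of d/dx exp (x c(s)) = c(s) exp (x c(s)).\<close>

lemma dexp_poly_ode:
  assumes "c 1 = 0" "n \<ge> 1"
  shows "poly (pderiv (dexp_poly c n)) x = (\<Sum>d | d dvd n. c d * poly (dexp_poly c (n div d)) x)"
proof -
  have "poly (pderiv (dexp_poly c n)) x
      = (\<Sum>k\<le>n. of_nat k * (cpow c k n / fact k) * x ^ (k - 1))"
    by (simp add: dexp_poly_def pderiv_sum pderiv_monom poly_sum poly_monom)
  also have "\<dots> = (\<Sum>k<n. of_nat (Suc k) * (cpow c (Suc k) n / fact (Suc k)) * x ^ k)"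
    by (subst sum.atMost_shift) simp
  also have "\<dots> = (\<Sum>k<n. \<Sum>d | d dvd n. c d * (cpow c k (n div d) / fact k * x ^ k))"
    unfolding of_nat_mult_div_fact_Suc
    by (simp add: dconv_def sum_distrib_right sum_divide_distrib mult.assoc)
  also have "\<dots> = (\<Sum>d | d dvd n. c d * (\<Sum>k<n. cpow c k (n div d) / fact k * x ^ k))"
    by (subst sum.swap) (simp add: sum_distrib_left)
  also have "\<dots> = (\<Sum>d | d dvd n. c d * poly (dexp_poly c (n div d)) x)"
  proof (intro sum.cong refl)
    fix d assume d: "d \<in> {d. d dvd n}"
    show "c d * (\<Sum>k<n. cpow c k (n div d) / fact k * x ^ k) = c d * poly (dexp_poly c (n div d)) x"
    \<comment> \<open>For \<open>d = 1\<close> the cut-off \<open>n\<close> does not lie beyond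
      \<open>n div d\<close>, but \<open>c 1 = 0\<close> removes that term.\<close>
    proof (cases "d = 1")
      case False
      with d assms have "1 \<le> n div d" "n div d < n"
        using codivisor_ge_1[of d n] codivisor_less[of d n] by auto
      then show ?thesis using assms by (simp add: poly_dexp_poly)
    qed (use assms(1) in simp)
  qed
  finally show ?thesis .
qed

lemma poly_eq_0_if_pderiv_eq_0:
  fixes p :: "complex poly"
  assumes "\<And>x. poly (pderiv p) x = 0" "poly p 0 = 0"
  shows "p = 0"
proof -
  have "pderiv p = 0" using assms(1) by (simp add: poly_all_0_iff_0[symmetric])
  then show ?thesis using assms(2) pderiv_iszero[of p] by auto
qed

text \<open>Since \<open>c 1 = 0\<close>, the derivative of \<beta>_n is determined by earlier
  members, and the value at 0 fixes the constant of integration. This recognises an exponential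
  without summing any series.\<close>

lemma dexp_poly_unique:
  assumes "c 1 = 0" "\<beta> 1 = 1" "\<And>n. n \<ge> 2 \<Longrightarrow> poly (\<beta> n) 0 = 0"
    and "\<And>n x. n \<ge> 2 \<Longrightarrow> poly (pderiv (\<beta> n)) x = (\<Sum>d | d dvd n. c d * poly (\<beta> (n div d)) x)"
    and "n \<ge> 1"
  shows "\<beta> n = dexp_poly c n"
  using assms(5)
proof (induction n rule: less_induct)
  case (less n)
  show ?case
  proof (cases "n = 1")
    case False
    with less.prems have n: "n \<ge> 2" by simp
    have "c d * poly (\<beta> (n div d)) x = c d * poly (dexp_poly c (n div d)) x" if "d dvd n" for d x
    proof (cases "d = 1")
      case False
      with that n have "1 \<le> n div d" "n div d < n"
        using codivisor_ge_1[of d n] codivisor_less[of d n] by auto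
      then show ?thesis using less.IH by simp
    qed (use assms(1) in simp)
    then have "(\<Sum>d | d dvd n. c d * poly (\<beta> (n div d)) x)
        = (\<Sum>d | d dvd n. c d * poly (dexp_poly c (n div d)) x)" for x
      by (intro sum.cong) auto
    then have "poly (pderiv (\<beta> n - dexp_poly c n)) x = 0" for x
      using n assms(1,4) by (simp add: pderiv_diff dexp_poly_ode)
    then have "\<beta> n - dexp_poly c n = 0"
      using n assms(3) by (intro poly_eq_0_if_pderiv_eq_0) (auto simp: poly_dexp_poly_0)
    then show ?thesis by simp
  qed (use assms(1,2) dexp_poly_1 in auto)
qed

section \<open>Multiplication by ln n as a derivation of the convolution algebra\<close>

lemma sum_divisors_swap:
  assumes "n \<ge> (1::nat)"
  shows "(\<Sum>d | d dvd n. \<Sum>e | e dvd n div d. F d e) = (\<Sum>e | e dvd n. \<Sum>d | d dvd n div e. F d e)"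
proof -
  have fin: "finite {d. d dvd n}" "d dvd n \<Longrightarrow> finite {e. e dvd n div d}" for d
    using assms by (auto simp: dvd_div_eq_0_iff intro!: finite_divisors_nat Nat.gr0I)
  have eq: "e dvd n div d \<longleftrightarrow> d * e dvd n" if "d dvd n" for d e
    using that assms by (subst dvd_div_iff_mult) (auto simp: mult.commute)
  have "(\<Sum>d | d dvd n. \<Sum>e | e dvd n div d. F d e) = (\<Sum>(d, e)\<in>{(d, e). d * e dvd n}. F d e)"
    using fin eq by (subst sum.Sigma) (auto intro!: sum.cong dest: dvd_mult_left)
  also have "\<dots> = (\<Sum>(e, d)\<in>{(e, d). e * d dvd n}. F d e)"
    by (rule sum.reindex_bij_witness[of _ prod.swap prod.swap]) (auto simp: mult.commute)
  also have "\<dots> = (\<Sum>e | e dvd n. \<Sum>d | d dvd n div e. F d e)"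
    using fin eq by (subst sum.Sigma) (auto intro!: sum.cong dest: dvd_mult_left)
  finally show ?thesis .
qed

lemma dconv_left_commute:
  assumes "n \<ge> 1"
  shows "dconv a (dconv b c) n = dconv b (dconv a c) n"
proof -
  have "dconv a (dconv b c) n
      = (\<Sum>d | d dvd n. \<Sum>e | e dvd n div d. a d * (b e * c (n div d div e)))"
    by (simp add: dconv_def sum_distrib_left)
  also have "\<dots> = (\<Sum>e | e dvd n. \<Sum>d | d dvd n div e. a d * (b e * c (n div d div e)))"
    by (rule sum_divisors_swap[OF assms])
  also have "\<dots> = dconv b (dconv a c) n"
    by (simp add: dconv_def sum_distrib_left mult.left_commute mult.commute flip: div_mult2_eq)
  finally show ?thesis .
qed

text \<open>The operator -d/ds on coefficients.\<close>

definition ln_mult :: "(nat \<Rightarrow> complex) \<Rightarrow> nat \<Rightarrow> complex" where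
  "ln_mult a n = of_real (ln (real n)) * a n"

lemma ln_div_of_dvd:
  assumes "d dvd n" "n \<ge> 1"
  shows "ln (real n) = ln (real d) + ln (real (n div d))"
proof -
  have "ln (real (d * (n div d))) = ln (real d) + ln (real (n div d))"
    using assms unfolding of_nat_mult
    by (intro ln_mult_pos) (auto simp: dvd_div_eq_0_iff intro!: Nat.gr0I)
  then show ?thesis using assms(1) by simp
qed

text \<open>The Leibniz rule, from ln n = ln d + ln (n/d).\<close>

lemma ln_mult_dconv:
  assumes "n \<ge> 1"
  shows "ln_mult (dconv a b) n = dconv (ln_mult a) b n + dconv a (ln_mult b) n"
proof -
  have "of_real (ln (real n)) * (a d * b (n div d))
      = ln_mult a d * b (n div d) + a d * ln_mult b (n div d)" if "d dvd n" for d
    unfolding ln_div_of_dvd[OF that assms] by (simp add: ln_mult_def algebra_simps)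
  then show ?thesis
    unfolding dconv_def ln_mult_def[of "\<lambda>n. \<Sum>d | d dvd n. a d * b (n div d)"]
    by (simp add: sum_distrib_left sum.distrib)
qed

text \<open>The power rule, by induction from the Leibniz rule.\<close>

lemma ln_mult_cpow:
  assumes "n \<ge> 1"
  shows "ln_mult (cpow c (Suc k)) n = of_nat (Suc k) * dconv (ln_mult c) (cpow c k) n"
  using assms
proof (induction k arbitrary: n)
  case 0
  have "ln_mult (cpow c 0) = (\<lambda>m. 0)" by (auto simp: ln_mult_def)
  then show ?case using ln_mult_dconv[OF 0, of c "cpow c 0"] by (simp add: dconv_def[of c "\<lambda>m. 0"])
next
  case (Suc k)
  have "dconv c (ln_mult (cpow c (Suc k))) n
      = (\<Sum>d | d dvd n. c d * (of_nat (Suc k) * dconv (ln_mult c) (cpow c k) (n div d)))"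
    unfolding dconv_def[of c] using Suc.prems
    by (intro sum.cong refl arg_cong2[where f = "(*)"] Suc.IH)
      (auto intro: codivisor_ge_1[unfolded One_nat_def])
  also have "\<dots> = of_nat (Suc k) * dconv c (dconv (ln_mult c) (cpow c k)) n"
    by (simp add: dconv_def[of c] sum_distrib_left mult_ac del: of_nat_Suc)
  also have "dconv c (dconv (ln_mult c) (cpow c k)) n = dconv (ln_mult c) (cpow c (Suc k)) n"
    using Suc.prems by (simp add: dconv_left_commute)
  finally show ?case
    using Suc.prems ln_mult_dconv[of n c "cpow c (Suc k)"] by (simp add: algebra_simps)
qed

text \<open>This is the derivative of \<open>exp (x c(s))\<close> with respect to \<open>s\<close>, coefficient by coefficient.\<close>

lemma ln_dexp_poly:
  assumes "c 1 = 0" "n \<ge> 1"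
  shows "of_real (ln (real n)) * poly (dexp_poly c n) x
    = x * (\<Sum>d | d dvd n. of_real (ln (real d)) * c d * poly (dexp_poly c (n div d)) x)"
proof -
  have "of_real (ln (real n)) * poly (dexp_poly c n) x
      = (\<Sum>k<Suc n. ln_mult (cpow c k) n / fact k * x ^ k)"
    unfolding poly_dexp_poly[where c = c, OF assms lessI] sum_distrib_left by (simp add: ln_mult_def mult_ac)
  \<comment> \<open>The term k = 0 vanishes: \<open>cpow c 0\<close> lives at n = 1, where ln n =
    0.\<close>
  also have "\<dots> = (\<Sum>k<n. ln_mult (cpow c (Suc k)) n / fact (Suc k) * x ^ Suc k)"
    by (subst sum.lessThan_Suc_shift) (simp add: ln_mult_def del: cpow.simps(2))
  also have "\<dots> = (\<Sum>k<n. x * (dconv (ln_mult c) (cpow c k) n / fact k * x ^ k))"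
    \<comment> \<open>The factor k + 1 of the power rule reduces the factorial from k + 1 to
      k.\<close>
    using assms(2) of_nat_mult_div_fact_Suc
    by (intro sum.cong refl) (simp add: ln_mult_cpow field_simps del: cpow.simps of_nat_Suc)
  also have "\<dots> = x * (\<Sum>k<n. \<Sum>d | d dvd n. ln_mult c d * (cpow c k (n div d) / fact k * x ^ k))"
    by (simp add: dconv_def sum_distrib_left sum_distrib_right sum_divide_distrib mult_ac)
  also have "\<dots> = x * (\<Sum>d | d dvd n. ln_mult c d * (\<Sum>k<n. cpow c k (n div d) / fact k * x ^ k))"
    by (subst sum.swap) (simp add: sum_distrib_left)
  also have "\<dots> = x * (\<Sum>d | d dvd n. of_real (ln (real d)) * c d * poly (dexp_poly c (n div d)) x)"
  proof (rule arg_cong2[where f = "(*)", OF refl], rule sum.cong[OF refl])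
    fix d assume d: "d \<in> {d. d dvd n}"
    show "ln_mult c d * (\<Sum>k<n. cpow c k (n div d) / fact k * x ^ k)
      = of_real (ln (real d)) * c d * poly (dexp_poly c (n div d)) x"
    proof (cases "d = 1")
      case False
      with d assms have "1 \<le> n div d" "n div d < n"
        using codivisor_ge_1[of d n] codivisor_less[of d n] by auto
      then show ?thesis using assms by (simp add: poly_dexp_poly ln_mult_def)
    qed (simp add: ln_mult_def)
  qed
  finally show ?thesis .
qed

lemma poly_hat_dexp_poly:
  assumes "n \<noteq> 1"
  shows "poly (hat_poly (dexp_poly c n)) x = (\<Sum>k<n. cpow c (Suc k) n / fact (Suc k) * x ^ k)"
proof -
  define q where "q = (\<Sum>k<n. monom (cpow c (Suc k) n / fact (Suc k)) k)"
  have "poly (dexp_poly c n) x = poly ([:0, 1:] * q) x" for x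
    unfolding dexp_poly_def q_def poly_sum poly_monom poly_mult
    by (subst sum.atMost_shift) (use assms in \<open>simp add: sum_distrib_left poly_sum poly_monom mult_ac\<close>)
  then have "dexp_poly c n = [:0, 1:] * q" by (rule poly_ext)
  then have "hat_poly (dexp_poly c n) = q"
    using nonzero_mult_div_cancel_left[of "[:0, 1:]" q] by (simp add: hat_poly_def)
  then show ?thesis by (simp add: q_def poly_sum poly_monom)
qed

section \<open>The polynomials generated by the solution\<close>

text \<open>The b_n of the overview, as polynomials so that \<open>pderiv\<close> applies. The index
  1 is separate because \<open>hat_poly 1\<close> is 0, whereas b_1 = 1.\<close>

definition lag_poly :: "(nat \<Rightarrow> complex) \<Rightarrow> complex \<Rightarrow> nat \<Rightarrow> complex poly" where
  "lag_poly f w n = (if n = 1 then 1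
     else [:0, 1:] * pcompose (hat_poly (dexp_poly f n)) [:w * of_real (ln (real n)), 1:])"

definition lag_coeff :: "(nat \<Rightarrow> complex) \<Rightarrow> complex \<Rightarrow> nat \<Rightarrow> complex" where
  "lag_coeff f w n = (if n \<ge> 2 then poly (hat_poly (dexp_poly f n)) (w * of_real (ln (real n))) else 0)"

lemma poly_lag_poly:
  "n \<noteq> 1 \<Longrightarrow> poly (lag_poly f w n) x = x * poly (hat_poly (dexp_poly f n)) (x + w * of_real (ln (real n)))"
  by (simp add: lag_poly_def poly_pcompose add.commute)

lemma poly_pderiv_lag_poly:
  "n \<noteq> 1 \<Longrightarrow> poly (pderiv (lag_poly f w n)) x
     = poly (hat_poly (dexp_poly f n)) (x + w * of_real (ln (real n)))
       + x * poly (pderiv (hat_poly (dexp_poly f n))) (x + w * of_real (ln (real n)))"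
  by (simp add: lag_poly_def pderiv_pCons pderiv_pcompose poly_pcompose add.commute)

text \<open>Multiplying the difference by x - a gives a polynomial with no exceptional point. This
  permits cancelling x + w ln n in the next identity.\<close>

lemma poly_eqI_except_one:
  fixes p q :: "complex poly"
  assumes "\<And>x. x \<noteq> a \<Longrightarrow> poly p x = poly q x"
  shows "p = q"
proof -
  have "poly ([:- a, 1:] * (p - q)) x = 0" for x using assms[of x] by (cases "x = a") auto
  then have "[:- a, 1:] * (p - q) = 0" using poly_all_0_iff_0 by blast
  then show ?thesis by (simp only: mult_eq_0_iff) simp
qed

text \<open>The coefficients of \<open>d/dx exp (x g(s)) = f(s - w g(s)) exp (x g(s))\<close>.\<close>

lemma pderiv_lag_poly:
  assumes "f 1 = 0" "n \<ge> 1"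
  shows "pderiv (lag_poly f w n)
    = (\<Sum>d | d dvd n. smult (f d) (pcompose (lag_poly f w (n div d)) [:w * of_real (ln (real d)), 1:]))"
proof (cases "n = 1")
  case True
  then show ?thesis using assms by (simp add: lag_poly_def)
next
  case False
  define l where "l k = (of_real (ln (real k)) :: complex)" for k :: nat
  define H where "H = hat_poly (dexp_poly f n)"
  have E: "dexp_poly f n = [:0, 1:] * H"
  proof -
    have "poly (dexp_poly f n) x = poly ([:0, 1:] * H) x" for x
      using poly_hat_poly[of "dexp_poly f n" x] poly_dexp_poly_0[OF False] by (simp add: H_def)
    then show ?thesis by (rule poly_ext)
  qed
  show ?thesis
  proof (rule poly_eqI_except_one[where a = "- w * of_real (ln (real n))"])
    fix x assume x: "x \<noteq> - w * of_real (ln (real n))"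
    define y where "y = x + w * l n"
    have y0: "y \<noteq> 0" using x by (auto simp: y_def l_def add_eq_0_iff2)
    \<comment> \<open>All the shifted hat polynomials are evaluated at the same point
      \<open>y\<close>, so the factor \<open>y\<close> turns each of them back into a
      \<open>dexp_poly\<close>.\<close>
    have "y * (f d * poly (lag_poly f w (n div d)) (x + w * l d))
        = f d * (x + w * l d) * poly (dexp_poly f (n div d)) y" if d: "d dvd n" for d
    proof (cases "d = n")
      case True
      then show ?thesis using assms dexp_poly_1[of f] by (simp add: lag_poly_def y_def)
    next
      case False
      then have d1: "n div d \<noteq> 1" using d assms by (auto elim: dvdE)
      have "l n = l d + l (n div d)" using ln_div_of_dvd[OF d] assms by (simp add: l_def)
      then have "x + w * l d + w * l (n div d) = y" by (simp add: y_def algebra_simps)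
      then have "y * poly (lag_poly f w (n div d)) (x + w * l d)
          = (x + w * l d) * (y * poly (hat_poly (dexp_poly f (n div d))) y)"
        using poly_lag_poly[OF d1] by (simp add: l_def)
      also have "\<dots> = (x + w * l d) * poly (dexp_poly f (n div d)) y"
        by (simp add: poly_hat_poly poly_dexp_poly_0[OF d1])
      finally show ?thesis by (simp add: mult_ac)
    qed
    then have "y * (\<Sum>d | d dvd n. f d * poly (lag_poly f w (n div d)) (x + w * l d))
        = (\<Sum>d | d dvd n. f d * (x + w * l d) * poly (dexp_poly f (n div d)) y)"
      unfolding sum_distrib_left by (intro sum.cong) auto
    \<comment> \<open>The factor x + w ln d splits the sum: the x-part is the recursion from d/dx,
      the w-part the one from d/ds with a factor \<open>y\<close> cancelled.\<close>
    also have "\<dots> = x * (\<Sum>d | d dvd n. f d * poly (dexp_poly f (n div d)) y)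
        + w * (\<Sum>d | d dvd n. l d * f d * poly (dexp_poly f (n div d)) y)"
      by (simp add: sum_distrib_left algebra_simps sum.distrib)
    also have "(\<Sum>d | d dvd n. f d * poly (dexp_poly f (n div d)) y) = poly H y + y * poly (pderiv H) y"
      unfolding dexp_poly_ode[where c = f, OF assms, symmetric] E
      by (simp add: pderiv_pCons)
    also have "(\<Sum>d | d dvd n. l d * f d * poly (dexp_poly f (n div d)) y) = l n * poly H y"
      using ln_dexp_poly[where c = f, OF assms, of y] y0 E by (simp add: l_def)
    also have "x * (poly H y + y * poly (pderiv H) y) + w * (l n * poly H y)
        = y * (poly H y + x * poly (pderiv H) y)"
      by (simp add: y_def algebra_simps)
    also have "poly H y + x * poly (pderiv H) y = poly (pderiv (lag_poly f w n)) x"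
      using False by (simp add: poly_pderiv_lag_poly H_def y_def l_def)
    finally show "poly (pderiv (lag_poly f w n)) x = poly (\<Sum>d | d dvd n. smult (f d)
        (pcompose (lag_poly f w (n div d)) [:w * of_real (ln (real d)), 1:])) x"
      using y0 by (simp add: poly_sum poly_pcompose l_def add.commute)
  qed
qed

lemma poly_lag_poly_0: "poly (lag_poly f w n) 0 = (if n = 1 then 1 else 0)"
  by (simp add: lag_poly_def)

text \<open>The defect \<open>P\<close> of the claim is constant: differentiate the shifted
  recursion, apply the induction hypothesis under the shifts, exchange the divisor sums and read the
  shifted recursion backwards. The constant is 0 because \<open>lag_coeff\<close> is the derivative
  at 0.\<close>

lemma lag_poly_ode:
  assumes "f 1 = 0" "n \<ge> 1"
  shows "pderiv (lag_poly f w n) = (\<Sum>d | d dvd n. smult (lag_coeff f w d) (lag_poly f w (n div d)))"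
  using assms(2)
proof (induction n rule: less_induct)
  case (less n)
  define g where "g = lag_coeff f w"
  define \<beta> where "\<beta> = lag_poly f w"
  define T where "T d = [:w * of_real (ln (real d)), 1:]" for d :: nat
  define P where "P = pderiv (\<beta> n) - (\<Sum>d | d dvd n. smult (g d) (\<beta> (n div d)))"
  have pos: "1 \<le> n div d" if "d dvd n" for d
    using that less.prems by (rule codivisor_ge_1)
  have star: "pderiv (\<beta> m) = (\<Sum>d | d dvd m. smult (f d) (pcompose (\<beta> (m div d)) (T d)))"
    if "m \<ge> 1" for m
    unfolding \<beta>_def T_def using assms(1) that by (rule pderiv_lag_poly)
  have pc: "pderiv (pcompose p (T d)) = pcompose (pderiv p) (T d)" for p d
    by (simp add: pderiv_pcompose T_def pderiv_pCons)
  have "pderiv (pderiv (\<beta> n)) = (\<Sum>a | a dvd n. smult (f a) (pcompose (pderiv (\<beta> (n div a))) (T a)))"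
    using less.prems by (simp add: star[of n] pderiv_sum pderiv_smult pc)
  also have "\<dots> = (\<Sum>a | a dvd n. \<Sum>d | d dvd n div a.
      smult (f a) (smult (g d) (pcompose (\<beta> (n div a div d)) (T a))))"
  proof (intro sum.cong refl)
    fix a assume a: "a \<in> {a. a dvd n}"
    show "smult (f a) (pcompose (pderiv (\<beta> (n div a))) (T a)) = (\<Sum>d | d dvd n div a.
        smult (f a) (smult (g d) (pcompose (\<beta> (n div a div d)) (T a))))"
    proof (cases "a = 1")
      \<comment> \<open>Only \<open>a \<noteq> 1\<close> needs the induction hypothesis, because
        \<open>f 1 = 0\<close>.\<close>
      case False
      with a less.prems have "n div a < n"
        by (intro codivisor_less) auto
      with a have "pderiv (\<beta> (n div a)) = (\<Sum>d | d dvd n div a. smult (g d) (\<beta> (n div a div d)))"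
        using less.IH[of "n div a"] pos by (simp add: g_def \<beta>_def)
      then show ?thesis
        by (simp add: pcompose_sum pcompose_smult smult_sum_right)
    qed (use assms(1) in simp)
  qed
  also have "\<dots> = (\<Sum>d | d dvd n. \<Sum>a | a dvd n div d.
      smult (f a) (smult (g d) (pcompose (\<beta> (n div a div d)) (T a))))"
    by (rule sum_divisors_swap[OF less.prems])
  also have "\<dots> = (\<Sum>d | d dvd n. smult (g d) (pderiv (\<beta> (n div d))))"
    using pos by (intro sum.cong refl)
      (simp add: star smult_sum_right mult.commute flip: div_mult2_eq)
  finally have "pderiv P = 0" by (simp add: P_def pderiv_diff pderiv_sum pderiv_smult)
  moreover have "poly P 0 = 0"
  proof -
    \<comment> \<open>At 0 only \<beta>_1 = 1 survives, that is, \<open>d = n\<close>.\<close>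
    have "(\<Sum>d | d dvd n. g d * poly (\<beta> (n div d)) 0) = (\<Sum>d\<in>{n}. g d)"
      using less.prems
      by (intro sum.mono_neutral_cong_right) (auto simp: \<beta>_def poly_lag_poly_0 elim!: dvdE)
    moreover have "poly (pderiv (\<beta> n)) 0 = g n"
    proof (cases "n = 1")
      case True
      then show ?thesis by (simp add: \<beta>_def g_def lag_poly_def lag_coeff_def)
    next
      case False
      then show ?thesis using less.prems by (simp add: \<beta>_def g_def poly_pderiv_lag_poly lag_coeff_def)
    qed
    ultimately show ?thesis by (simp add: P_def poly_sum)
  qed
  ultimately have "P = 0" by (intro poly_eq_0_if_pderiv_eq_0) auto
  then show ?case by (simp add: P_def g_def \<beta>_def)
qed

text \<open>The b_n solve the initial value problem that characterises exp (x g(s)). Both the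
  functional equation and the exponential formula rest on this.\<close>

lemma lag_poly_eq_dexp_poly:
  assumes "f 1 = 0" "n \<ge> 1"
  shows "lag_poly f w n = dexp_poly (lag_coeff f w) n"
proof (rule dexp_poly_unique[OF _ _ _ _ assms(2)])
  fix n :: nat and x :: complex assume "n \<ge> 2"
  then show "poly (pderiv (lag_poly f w n)) x
      = (\<Sum>d | d dvd n. lag_coeff f w d * poly (lag_poly f w (n div d)) x)"
    using lag_poly_ode[of f n w] assms(1) by (simp add: poly_sum)
qed (auto simp: lag_coeff_def poly_lag_poly_0 lag_poly_def)

section \<open>Exponentials of Dirichlet series\<close>

lemma
  assumes "ds_abs_conv c s"
  shows ds_abs_conv_cpow: "ds_abs_conv (cpow c k) s"
    and ds_eval_cpow: "ds_eval (cpow c k) s = ds_eval c s ^ k"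
    and ds_norm_cpow: "ds_norm (cpow c k) (Re s) \<le> ds_norm c (Re s) ^ k"
proof -
  have "ds_abs_conv (cpow c k) s \<and> ds_eval (cpow c k) s = ds_eval c s ^ k
      \<and> ds_norm (cpow c k) (Re s) \<le> ds_norm c (Re s) ^ k"
  proof (induction k)
    case 0
    have "(\<lambda>n. norm (cpow c 0 n / of_nat n powr s)) summable_on {1..}
        \<longleftrightarrow> (\<lambda>n. norm (cpow c 0 n / of_nat n powr s)) summable_on {1}"
      by (rule summable_on_cong_neutral) auto
    then have "ds_abs_conv (cpow c 0) s"
      unfolding ds_abs_conv_def by simp
    moreover have "ds_eval (cpow c 0) s = infsum (\<lambda>n. cpow c 0 n / of_nat n powr s) {1}"
      unfolding ds_eval_def by (rule infsum_cong_neutral) auto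
    moreover have "ds_norm (cpow c 0) (Re s) = infsum (\<lambda>n. norm (cpow c 0 n) / real n powr Re s) {1}"
      unfolding ds_norm_def by (rule infsum_cong_neutral) auto
    ultimately show ?case by simp
  next
    case (Suc k)
    have "ds_norm (dconv c (cpow c k)) (Re s) \<le> ds_norm c (Re s) * ds_norm (cpow c k) (Re s)"
      using assms Suc.IH by (intro ds_norm_dconv) auto
    also have "\<dots> \<le> ds_norm c (Re s) * ds_norm c (Re s) ^ k"
      using Suc.IH by (intro mult_left_mono ds_norm_nonneg) auto
    finally show ?case using assms Suc.IH by (simp add: ds_abs_conv_dconv ds_eval_dconv)
  qed
  then show "ds_abs_conv (cpow c k) s" "ds_eval (cpow c k) s = ds_eval c s ^ k"
    "ds_norm (cpow c k) (Re s) \<le> ds_norm c (Re s) ^ k" by auto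
qed

lemma has_sum_exp: "((\<lambda>k. x ^ k / fact k) has_sum exp x) (UNIV :: nat set)" for x :: "'a :: {real_normed_field, banach}"
proof (rule norm_summable_imp_has_sum)
  show "summable (\<lambda>k. norm (x ^ k / fact k))"
    using summable_norm_exp[of x] by (simp add: divide_inverse scaleR_conv_of_real mult.commute)
  show "(\<lambda>k. x ^ k / fact k) sums exp x"
    using exp_converges[of x] by (simp add: divide_inverse scaleR_conv_of_real mult.commute)
qed

text \<open>The double series over powers k and indices n is dominated by the exponential series of
  \<open>norm x * ds_norm c (Re s)\<close>, so the sums may be exchanged; for fixed n the sum over k
  stops at n. The norm bound later makes the composition converge.\<close>

lemma
  assumes "ds_abs_conv c s" "c 1 = 0"
  shows ds_abs_conv_dexp: "ds_abs_conv (\<lambda>n. poly (dexp_poly c n) x) s"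
    and ds_eval_dexp: "ds_eval (\<lambda>n. poly (dexp_poly c n) x) s = exp (x * ds_eval c s)"
    and ds_norm_dexp: "ds_norm (\<lambda>n. poly (dexp_poly c n) x) (Re s) \<le> exp (norm x * ds_norm c (Re s))"
proof -
  define h where "h k n = x ^ k / fact k * (cpow c k n / of_nat n powr s)" for k n
  define M where "M k = (norm x * ds_norm c (Re s)) ^ k / fact k" for k :: nat
  have M: "(M has_sum exp (norm x * ds_norm c (Re s))) UNIV"
    unfolding M_def by (rule has_sum_exp)
  have hs: "(\<lambda>n. norm (h k n)) summable_on {1..}" for k
    unfolding h_def norm_mult using ds_abs_conv_cpow[OF assms(1), of k]
    by (intro summable_on_cmult_right) (simp add: ds_abs_conv_def)
  have hM: "(\<Sum>\<^sub>\<infinity>n\<in>{1..}. norm (h k n)) \<le> M k" for k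
  proof -
    have "(\<Sum>\<^sub>\<infinity>n\<in>{1..}. norm (h k n)) = norm (x ^ k / fact k) * ds_norm (cpow c k) (Re s)"
      unfolding h_def norm_mult ds_norm_eq by (rule infsum_cmult_right')
    also have "\<dots> \<le> norm (x ^ k / fact k) * ds_norm c (Re s) ^ k"
      by (intro mult_left_mono ds_norm_cpow assms) simp
    also have "\<dots> = M k" by (simp add: M_def norm_divide norm_power power_mult_distrib)
    finally show ?thesis .
  qed
  have S: "(\<lambda>z. norm (case z of (k, n) \<Rightarrow> h k n)) summable_on (UNIV \<times> {1..})"
    using hs M hM by (intro abs_summable_on_Times) (auto simp: has_sum_iff)
  then have S': "(\<lambda>(k, n). norm (h k n)) summable_on (UNIV \<times> {1..})" by (simp add: case_prod_unfold)
  have T: "(\<lambda>(n, k). norm (h k n)) summable_on ({1..} \<times> UNIV)"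
    using S' summable_on_swap[of "\<lambda>(k, n). norm (h k n)" UNIV "{1..}"] by (simp add: case_prod_unfold)
  have nz: "h k n = 0" if "n \<in> {1..}" "k \<notin> {..n}" for k n
    using that cpow_eq_0[where c = c, OF assms(2), of n k] by (simp add: h_def)
  have coeff: "poly (dexp_poly c n) x / of_nat n powr s = (\<Sum>k\<le>n. h k n)" for n
    by (simp add: dexp_poly_def poly_sum poly_monom sum_divide_distrib h_def mult_ac)
  have hsum: "(\<Sum>\<^sub>\<infinity>k. h k n) = (\<Sum>k\<le>n. h k n)" if "n \<in> {1..}" for n
    using nz[OF that] infsum_cong_neutral[of "{..n}" UNIV "\<lambda>k. h k n" "\<lambda>k. h k n"] by simp
  have hnorm: "(\<Sum>\<^sub>\<infinity>k. norm (h k n)) = (\<Sum>k\<le>n. norm (h k n))" if "n \<in> {1..}" for n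
    using nz[OF that] infsum_cong_neutral[of "{..n}" UNIV "\<lambda>k. norm (h k n)" "\<lambda>k. norm (h k n)"] by simp
  have N: "(\<lambda>n. \<Sum>k\<le>n. norm (h k n)) summable_on {1..}"
    using summable_on_Sigma_banach[OF T] by (rule summable_on_cong[THEN iffD1, rotated]) (rule hnorm)
  have le: "norm (poly (dexp_poly c n) x / of_nat n powr s) \<le> (\<Sum>k\<le>n. norm (h k n))" for n
    unfolding coeff by (rule norm_sum)
  show conv: "ds_abs_conv (\<lambda>n. poly (dexp_poly c n) x) s"
    unfolding ds_abs_conv_def by (rule summable_on_comparison_test[OF N le]) simp
  have "ds_eval (\<lambda>n. poly (dexp_poly c n) x) s = (\<Sum>\<^sub>\<infinity>n\<in>{1..}. \<Sum>\<^sub>\<infinity>k. h k n)"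
    unfolding ds_eval_def coeff by (intro infsum_cong hsum[symmetric])
  also have "\<dots> = (\<Sum>\<^sub>\<infinity>k. \<Sum>\<^sub>\<infinity>n\<in>{1..}. h k n)"
    by (rule infsum_swap_banach[symmetric, OF abs_summable_summable[OF S]])
  also have "\<dots> = (\<Sum>\<^sub>\<infinity>k. (x * ds_eval c s) ^ k / fact k)"
    unfolding h_def infsum_cmult_right' ds_eval_def[symmetric] ds_eval_cpow[OF assms(1)]
    by (simp add: power_mult_distrib)
  also have "\<dots> = exp (x * ds_eval c s)"
    using has_sum_exp by (rule infsumI)
  finally show "ds_eval (\<lambda>n. poly (dexp_poly c n) x) s = exp (x * ds_eval c s)" .
  have "ds_norm (\<lambda>n. poly (dexp_poly c n) x) (Re s) \<le> (\<Sum>\<^sub>\<infinity>n\<in>{1..}. \<Sum>k\<le>n. norm (h k n))"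
    unfolding ds_norm_eq using conv by (intro infsum_mono[OF _ N le]) (simp add: ds_abs_conv_def)
  also have "\<dots> = (\<Sum>\<^sub>\<infinity>n\<in>{1..}. \<Sum>\<^sub>\<infinity>k. norm (h k n))"
    by (intro infsum_cong hnorm[symmetric])
  also have "\<dots> = (\<Sum>\<^sub>\<infinity>k. \<Sum>\<^sub>\<infinity>n\<in>{1..}. norm (h k n))"
    by (rule infsum_swap_banach[symmetric, OF S'])
  also have "\<dots> \<le> infsum M UNIV"
    using summable_on_Sigma_banach[OF S'] M hM by (intro infsum_mono) (auto simp: has_sum_iff)
  also have "\<dots> = exp (norm x * ds_norm c (Re s))" using M by (rule infsumI)
  finally show "ds_norm (\<lambda>n. poly (dexp_poly c n) x) (Re s) \<le> exp (norm x * ds_norm c (Re s))" .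
qed

text \<open>Each power is bounded through its norm by F^(k+1) n^(Re s); one factor F comes out and
  the rest is a partial sum of exp (|x| F).\<close>

lemma norm_poly_hat_dexp_le:
  assumes "ds_abs_conv c s" "n \<ge> 2"
  defines "F \<equiv> ds_norm c (Re s)"
  shows "norm (poly (hat_poly (dexp_poly c n)) x) \<le> F * exp (norm x * F) * real n powr Re s"
proof -
  have F: "F \<ge> 0" by (simp add: F_def ds_norm_nonneg)
  have "norm (poly (hat_poly (dexp_poly c n)) x)
      \<le> (\<Sum>k<n. norm (cpow c (Suc k) n / fact (Suc k) * x ^ k))"
    using assms(2) by (subst poly_hat_dexp_poly) (auto intro: norm_sum)
  also have "\<dots> \<le> (\<Sum>k<n. F * real n powr Re s * ((norm x * F) ^ k / fact k))"
  proof (rule sum_mono)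
    fix k
    have "norm (cpow c (Suc k) n) \<le> ds_norm (cpow c (Suc k)) (Re s) * real n powr Re s"
      using assms(2) by (intro coeff_bound ds_abs_conv_cpow assms) auto
    also have "\<dots> \<le> F ^ Suc k * real n powr Re s"
      unfolding F_def by (intro mult_right_mono ds_norm_cpow assms) auto
    \<comment> \<open>Weakening 1/(k+1)! to 1/k! matches the exponential series.\<close>
    finally have "norm (cpow c (Suc k) n) / fact (Suc k) \<le> F ^ Suc k * real n powr Re s / fact k"
      using F by (intro frac_le fact_mono) auto
    then have "norm (cpow c (Suc k) n) / fact (Suc k) * norm x ^ k
        \<le> F ^ Suc k * real n powr Re s / fact k * norm x ^ k"
      by (rule mult_right_mono) simp
    then show "norm (cpow c (Suc k) n / fact (Suc k) * x ^ k)
        \<le> F * real n powr Re s * ((norm x * F) ^ k / fact k)"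
      by (simp only: norm_mult norm_divide norm_power norm_fact power_mult_distrib power_Suc)
        (simp add: mult_ac)
  qed
  also have "\<dots> = F * real n powr Re s * (\<Sum>k<n. (norm x * F) ^ k / fact k)"
    by (simp add: sum_distrib_left)
  also have "\<dots> \<le> F * real n powr Re s * exp (norm x * F)"
  proof (intro mult_left_mono)
    have "(\<Sum>k\<in>{..<n}. (norm x * F) ^ k / fact k) \<le> (\<Sum>\<^sub>\<infinity>k. (norm x * F) ^ k / fact k)"
      using F has_sum_exp[of "norm x * F"]
      by (intro finite_sum_le_infsum) (auto simp: has_sum_iff)
    then show "(\<Sum>k<n. (norm x * F) ^ k / fact k) \<le> exp (norm x * F)"
      using infsumI[OF has_sum_exp[of "norm x * F"]] by simp
  qed (use F in auto)
  finally show ?thesis by (simp add: mult_ac)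
qed

text \<open>The bound on \<open>Re s\<close> does not involve \<open>x\<close>, since \<open>exp ((\<bar>x\<bar> + \<bar>w\<bar> ln n) F) = exp (\<bar>x\<bar> F) n\<^bsup>\<bar>w\<bar> F\<^esup>\<close>.\<close>

lemma hat_dexp_abs_conv:
  assumes "ds_abs_conv c t" "Re s > Re t + norm w * ds_norm c (Re t) + 1"
  shows "ds_abs_conv (\<lambda>n. if n \<ge> 2 then poly (hat_poly (dexp_poly c n)) (x + w * of_real (ln (real n))) else 0) s"
proof (rule polynomial_growth_abs_conv)
  define F where "F = ds_norm c (Re t)"
  have F: "F \<ge> 0" by (simp add: F_def ds_norm_nonneg)
  show "norm (if n \<ge> 2 then poly (hat_poly (dexp_poly c n)) (x + w * of_real (ln (real n))) else 0)
      \<le> F * exp (norm x * F) * real n powr (Re t + norm w * F)" if n: "n \<ge> 1" for n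
  proof (cases "n \<ge> 2")
    case True
    have "norm (x + w * of_real (ln (real n))) \<le> norm x + norm w * ln (real n)"
      using n by (intro norm_triangle_le) (simp add: norm_mult)
    then have "F * exp (norm (x + w * of_real (ln (real n))) * F) * real n powr Re t
        \<le> F * exp ((norm x + norm w * ln (real n)) * F) * real n powr Re t"
      using F by (intro mult_right_mono mult_left_mono) (auto intro: mult_right_mono)
    also have "\<dots> = F * exp (norm x * F) * real n powr (Re t + norm w * F)"
      using n by (simp add: powr_def exp_add[symmetric] algebra_simps)
    finally show ?thesis
      using norm_poly_hat_dexp_le[OF assms(1) True, of "x + w * of_real (ln (real n))"] True
      by (simp add: F_def)
  qed (use F in auto)
  show "Re t + norm w * F + 1 < Re s" using assms(2) by (simp add: F_def)
qed

section \<open>The functional equation\<close>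

text \<open>Expand a^(-(s - w g(s))) = a^(-s) exp (w ln a g(s)) by the exponential series of g at x
  = w ln a. Its norm is at most a^(|w| G) with G = \<open>ds_norm g (Re s)\<close>, which is why f
  must converge absolutely at Re s - |w| G.\<close>

lemma ds_eval_composition:
  assumes "f 1 = 0" "g 1 = 0" "ds_abs_conv g s"
    and "ds_abs_conv f (of_real (Re s - norm w * ds_norm g (Re s)))"
  shows "ds_abs_conv f (s - w * ds_eval g s)"
    and "ds_eval f (s - w * ds_eval g s) = (\<Sum>\<^sub>\<infinity>n\<in>{1..}.
      (\<Sum>d | d dvd n. f d * poly (dexp_poly g (n div d)) (w * of_real (ln (real d)))) / of_nat n powr s)"
proof -
  define G where "G = ds_norm g (Re s)"
  define l where "l d = (of_real (ln (real d)) :: complex)" for d :: nat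
  define h where "h a b = f a / of_nat a powr s * (poly (dexp_poly g b) (w * l a) / of_nat b powr s)"
    for a b :: nat
  have "Re (w * ds_eval g s) \<le> norm w * G"
    using complex_Re_le_cmod[of "w * ds_eval g s"] norm_ds_eval_le[OF assms(3)]
    by (auto simp: norm_mult G_def intro: order_trans[OF _ mult_left_mono])
  then show "ds_abs_conv f (s - w * ds_eval g s)"
    by (intro ds_abs_conv_mono[OF assms(4)]) (simp add: G_def)
  have powr_l: "of_nat a powr (u::complex) = exp (l a * u)" if "a \<in> {1..}" for a u
    using that by (simp add: powr_def l_def mult.commute flip: Ln_of_nat)
  have hs: "(\<lambda>b. norm (h a b)) summable_on {1..}" for a
    unfolding h_def norm_mult using ds_abs_conv_dexp[where c = g, OF assms(3,2)]
    by (intro summable_on_cmult_right) (simp add: ds_abs_conv_def)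
  have "(\<Sum>\<^sub>\<infinity>b\<in>{1..}. norm (h a b)) \<le> norm (f a) / real a powr (Re s - norm w * G)"
    if a: "a \<in> {1..}" for a
  proof -
    have "(\<Sum>\<^sub>\<infinity>b\<in>{1..}. norm (h a b))
        = norm (f a / of_nat a powr s) * ds_norm (\<lambda>b. poly (dexp_poly g b) (w * l a)) (Re s)"
      unfolding h_def norm_mult ds_norm_eq by (rule infsum_cmult_right')
    also have "\<dots> \<le> norm (f a / of_nat a powr s) * exp (norm (w * l a) * G)"
      unfolding G_def by (intro mult_left_mono ds_norm_dexp assms) simp
    also have "norm (f a / of_nat a powr s) = norm (f a) / real a powr Re s"
      using a by (intro norm_ds_term) simp
    also have "exp (norm (w * l a) * G) = real a powr (norm w * G)"
      using a by (simp add: powr_def norm_mult l_def mult_ac)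
    finally show ?thesis by (simp add: powr_diff)
  qed
  moreover have "(\<lambda>a. norm (f a) / real a powr (Re s - norm w * G)) summable_on {1..}"
    using assms(4) by (simp add: ds_abs_conv_iff G_def)
  ultimately have S: "(\<lambda>z. norm (case z of (a, b) \<Rightarrow> h a b)) summable_on ({1..} \<times> {1..})"
    using hs by (intro abs_summable_on_Times) auto
  have "(\<Sum>\<^sub>\<infinity>b\<in>{1..}. h a b) = f a / of_nat a powr (s - w * ds_eval g s)" if a: "a \<in> {1..}" for a
  proof -
    have "(\<Sum>\<^sub>\<infinity>b\<in>{1..}. h a b) = f a / of_nat a powr s * exp (w * l a * ds_eval g s)"
      unfolding h_def infsum_cmult_right'
      using ds_eval_dexp[where c = g, OF assms(3,2), of "w * l a"] by (simp add: ds_eval_def)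
    also have "\<dots> = f a / of_nat a powr (s - w * ds_eval g s)"
      using a by (simp add: powr_l right_diff_distrib exp_diff mult_ac)
    finally show ?thesis .
  qed
  then have "ds_eval f (s - w * ds_eval g s) = (\<Sum>\<^sub>\<infinity>a\<in>{1..}. \<Sum>\<^sub>\<infinity>b\<in>{1..}. h a b)"
    unfolding ds_eval_def[of f] by (intro infsum_cong) simp
  also have "\<dots> = (\<Sum>\<^sub>\<infinity>n\<in>{1..}. \<Sum>d | d dvd n. h d (n div d))"
    by (rule infsum_by_divisors(2)[symmetric, OF abs_summable_summable[OF S]])
  also have "(\<lambda>n. \<Sum>d | d dvd n. h d (n div d)) = (\<lambda>n. (\<Sum>d | d dvd n.
      f d * poly (dexp_poly g (n div d)) (w * l d)) / of_nat n powr s)"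
    unfolding sum_divide_distrib
  proof (intro ext sum.cong refl)
    fix n d :: nat assume "d \<in> {d. d dvd n}"
    then show "h d (n div d) = f d * poly (dexp_poly g (n div d)) (w * l d) / of_nat n powr s"
      using ds_term_mult[of d "n div d" s] by (simp add: h_def)
  qed
  finally show "ds_eval f (s - w * ds_eval g s) = (\<Sum>\<^sub>\<infinity>n\<in>{1..}.
      (\<Sum>d | d dvd n. f d * poly (dexp_poly g (n div d)) (w * of_real (ln (real d)))) / of_nat n powr s)"
    by (simp add: l_def)
qed

lemma dirichlet_D0_D: "c \<in> dirichlet_D0 \<Longrightarrow> c 1 = 0" "c \<in> dirichlet_D0 \<Longrightarrow> c 0 = 0"
  by (auto simp: dirichlet_D0_def dirichlet_D_def)

lemma lag_coeff_D0:
  assumes "f \<in> dirichlet_D0"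
  shows "lag_coeff f w \<in> dirichlet_D0"
proof -
  obtain \<sigma> where \<sigma>: "\<And>s. Re s \<ge> \<sigma> \<Longrightarrow> ds_abs_conv f s" using dirichlet_D0_abs_conv[OF assms] by blast
  have "lag_coeff f w = (\<lambda>n. if n \<ge> 2 then poly (hat_poly (dexp_poly f n)) (0 + w * of_real (ln (real n))) else 0)"
    by (auto simp: lag_coeff_def)
  then have "ds_abs_conv (lag_coeff f w) s" if "Re s > \<sigma> + norm w * ds_norm f \<sigma> + 1" for s
    using hat_dexp_abs_conv[of f "of_real \<sigma>" w s 0] \<sigma> that by simp
  then show ?thesis
    by (auto simp: dirichlet_D0_def dirichlet_D_def half_plane_def lag_coeff_def
        intro!: exI[of _ "\<sigma> + norm w * ds_norm f \<sigma> + 1"])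
qed

lemma ds_norm_antimono:
  assumes "ds_abs_conv c s" "Re s \<le> \<sigma>"
  shows "ds_norm c \<sigma> \<le> ds_norm c (Re s)"
  using ds_norm_shift_le[OF assms(1), of 1 "\<sigma> - Re s"] assms(2) by simp

lemma lag_coeff_solves:
  assumes "f \<in> dirichlet_D0"
  shows "solves_ds_equation f w (lag_coeff f w)"
proof -
  define g where "g = lag_coeff f w"
  have f1: "f 1 = 0" and g1: "g 1 = 0" using assms lag_coeff_D0[OF assms, of w] dirichlet_D0_D
    by (auto simp: g_def lag_coeff_def)
  obtain \<sigma> where \<sigma>: "\<And>s. Re s \<ge> \<sigma> \<Longrightarrow> ds_abs_conv f s" using dirichlet_D0_abs_conv[OF assms] by blast
  obtain \<tau> where \<tau>: "\<And>s. Re s \<ge> \<tau> \<Longrightarrow> ds_abs_conv g s"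
    using dirichlet_D0_abs_conv[OF lag_coeff_D0[OF assms, of w]] unfolding g_def by blast
  have "ds_abs_conv g s \<and> ds_abs_conv f (s - w * ds_eval g s) \<and> ds_eval f (s - w * ds_eval g s) = ds_eval g s"
    \<comment> \<open>The second bound keeps \<open>Re s - norm w * ds_norm g (Re s)\<close> at or
      to the right of \<sigma>, since the norm of g decreases in Re s.\<close>
    if s: "Re s \<ge> \<tau>" "Re s \<ge> \<sigma> + norm w * ds_norm g \<tau>" for s
  proof -
    have gs: "ds_abs_conv g s" using \<tau> s(1) .
    have "norm w * ds_norm g (Re s) \<le> norm w * ds_norm g \<tau>"
      using ds_norm_antimono[OF \<tau>, of "of_real \<tau>" "Re s"] s(1) by (intro mult_left_mono) auto
    then have fs: "ds_abs_conv f (of_real (Re s - norm w * ds_norm g (Re s)))"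
      using s(2) by (intro \<sigma>) simp
    have "(\<Sum>d | d dvd n. f d * poly (dexp_poly g (n div d)) (w * of_real (ln (real d)))) = g n"
      if n: "n \<ge> 1" for n
    proof -
      have "(\<Sum>d | d dvd n. f d * poly (dexp_poly g (n div d)) (w * of_real (ln (real d))))
          = (\<Sum>d | d dvd n. f d * poly (lag_poly f w (n div d)) (w * of_real (ln (real d))))"
        using lag_poly_eq_dexp_poly[where f = f, OF f1] codivisor_ge_1 n unfolding g_def
        by (intro sum.cong refl) auto
      \<comment> \<open>At x = 0 the shift by w ln d becomes the argument w ln d.\<close>
      also have "\<dots> = poly (pderiv (lag_poly f w n)) 0"
        using n f1 by (simp add: pderiv_lag_poly poly_sum poly_pcompose)
      also have "\<dots> = g n"
      proof (cases "n = 1")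
        case True
        then show ?thesis using g1 by (simp add: lag_poly_def)
      next
        case False
        then show ?thesis using n by (simp add: g_def poly_pderiv_lag_poly lag_coeff_def)
      qed
      finally show ?thesis .
    qed
    then have "ds_eval f (s - w * ds_eval g s) = ds_eval g s"
      unfolding ds_eval_composition(2)[where f = f and g = g, OF f1 g1 gs fs]
      unfolding ds_eval_def[of g] by (intro infsum_cong) simp
    then show ?thesis using gs ds_eval_composition(1)[where f = f and g = g, OF f1 g1 gs fs] by blast
  qed
  then show ?thesis
    unfolding solves_ds_equation_def g_def[symmetric]
    by (intro exI[of _ "max \<tau> (\<sigma> + norm w * ds_norm g \<tau>)"]) (auto simp: half_plane_def)
qed

section \<open>Contraction and uniqueness of the solution\<close>

lemma norm_inverse_powr_diff_le:
  assumes "n \<ge> 1" "Re a \<ge> \<sigma>" "Re b \<ge> \<sigma>"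
  shows "norm (1 / of_nat n powr a - 1 / of_nat n powr b) \<le> ln (real n) / real n powr \<sigma> * norm (a - b)"
proof (rule field_differentiable_bound[where S = "{z. \<sigma> \<le> Re z}"])
  have eq: "1 / of_nat n powr (z::complex) = exp (- of_real (ln (real n)) * z)" for z
    using assms(1) by (simp add: powr_def exp_minus field_simps flip: Ln_of_nat)
  show "convex {z. \<sigma> \<le> Re z}" by (rule convex_halfspace_Re_ge)
  show "((\<lambda>z. 1 / of_nat n powr z) has_field_derivative
      - of_real (ln (real n)) * exp (- of_real (ln (real n)) * z)) (at z within {z. \<sigma> \<le> Re z})" for z
    unfolding eq by (auto intro!: derivative_eq_intros)
  fix z assume z: "z \<in> {z. \<sigma> \<le> Re z}"
  have "exp (- (ln (real n) * Re z)) \<le> exp (- (ln (real n) * \<sigma>))"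
    using z assms(1) by (auto intro: mult_left_mono)
  then have "ln (real n) * exp (- (ln (real n) * Re z)) \<le> ln (real n) * exp (- (ln (real n) * \<sigma>))"
    using assms(1) by (intro mult_left_mono) auto
  moreover have "norm (- of_real (ln (real n)) * exp (- of_real (ln (real n)) * z))
      = ln (real n) * exp (- (ln (real n) * Re z))"
    using assms(1) by (simp add: norm_mult)
  moreover have "ln (real n) * exp (- (ln (real n) * \<sigma>)) = ln (real n) / real n powr \<sigma>"
    using assms(1) by (simp add: powr_def exp_minus divide_inverse mult.commute)
  ultimately show "norm (- of_real (ln (real n)) * exp (- of_real (ln (real n)) * z))
      \<le> ln (real n) / real n powr \<sigma>"
    by simp
qed (use assms in auto)

text \<open>The mean value bound is applied term by term; its factor ln n <= n costs one unit of
  abscissa, hence \<sigma> + 1.\<close>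

lemma ds_eval_lipschitz:
  assumes "ds_abs_conv c (of_real \<sigma>)" "Re a \<ge> \<sigma> + 1" "Re b \<ge> \<sigma> + 1"
  shows "norm (ds_eval c a - ds_eval c b) \<le> ds_norm c \<sigma> * norm (a - b)"
proof -
  have conv: "ds_abs_conv c a" "ds_abs_conv c b" using assms by (auto intro: ds_abs_conv_mono[OF assms(1)])
  define L where "L n = norm (c n) / real n powr \<sigma> * norm (a - b)" for n
  have L: "L summable_on {1..}"
    using assms(1) unfolding L_def by (intro summable_on_cmult_left) (simp add: ds_abs_conv_iff)
  have le: "norm (c n / of_nat n powr a - c n / of_nat n powr b) \<le> L n" if n: "n \<in> {1..}" for n
  proof -
    have "norm (c n / of_nat n powr a - c n / of_nat n powr b)
        = norm (c n) * norm (1 / of_nat n powr a - 1 / of_nat n powr b)"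
      by (simp add: right_diff_distrib flip: norm_mult)
    also have "\<dots> \<le> norm (c n) * (ln (real n) / real n powr (\<sigma> + 1) * norm (a - b))"
      using n assms by (intro mult_left_mono norm_inverse_powr_diff_le) auto
    also have "\<dots> \<le> norm (c n) * (real n / real n powr (\<sigma> + 1) * norm (a - b))"
      using n by (intro mult_left_mono mult_right_mono divide_right_mono ln_bound) auto
    also have "\<dots> = L n" using n by (simp add: L_def powr_add field_simps)
    finally show ?thesis .
  qed
  have D: "(\<lambda>n. norm (c n / of_nat n powr a - c n / of_nat n powr b)) summable_on {1..}"
    by (rule summable_on_comparison_test[OF L le]) auto
  have "ds_eval c a - ds_eval c b = (\<Sum>\<^sub>\<infinity>n\<in>{1..}. c n / of_nat n powr a + - (c n / of_nat n powr b))"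
    using conv[THEN ds_abs_conv_summable]
    by (subst infsum_add) (auto simp: summable_on_uminus infsum_uminus ds_eval_def)
  also have "norm \<dots> \<le> (\<Sum>\<^sub>\<infinity>n\<in>{1..}. norm (c n / of_nat n powr a - c n / of_nat n powr b))"
    using norm_infsum_bound[OF D] by simp
  also have "\<dots> \<le> infsum L {1..}" by (rule infsum_mono[OF D L le])
  also have "\<dots> = ds_norm c \<sigma> * norm (a - b)"
    unfolding L_def ds_norm_def by (rule infsum_cmult_left')
  finally show ?thesis .
qed

lemma ds_norm_eventually_small:
  assumes "ds_abs_conv c (of_real \<sigma>)" "c 1 = 0" "\<epsilon> > 0"
  obtains \<tau> where "\<tau> \<ge> \<sigma>" "ds_norm c \<tau> < \<epsilon>"
proof -
  define K where "K = ds_norm c \<sigma>"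
  have K: "K \<ge> 0" by (simp add: K_def ds_norm_nonneg)
  \<comment> \<open>With c_1 = 0 the norm decays at least like 2^(-t); this \<open>t\<close> makes
    2^t exceed K/\<epsilon>, and the added 1 keeps it nonnegative.\<close>
  define t where "t = log 2 (1 + K / \<epsilon>)"
  have p: "2 powr t = 1 + K / \<epsilon>" using K assms(3) by (simp add: t_def add_pos_nonneg)
  have "t \<ge> 0" using K assms(3) unfolding t_def by (subst zero_le_log_cancel_iff) (auto simp: add_pos_nonneg)
  moreover have "c n = 0" if "1 \<le> n" "n < 2" for n using that assms(2) by (simp add: less_Suc_eq numeral_2_eq_2)
  ultimately have "ds_norm c (\<sigma> + t) \<le> K / 2 powr t"
    using ds_norm_shift_le[OF assms(1), of 2 t] by (simp add: K_def)
  also have "\<dots> < \<epsilon>" using K assms(3) by (simp add: p field_simps)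
  finally show ?thesis using that[of "\<sigma> + t"] \<open>t \<ge> 0\<close> by simp
qed

text \<open>Far to the right \<open>f\<close> is Lipschitz with constant \<open>L\<close> such that \<open>\<bar>w\<bar> L < 1\<close>, so that
  \<open>g = f(s - w g)\<close> determines \<open>g(s)\<close> by contraction.\<close>

lemma solution_unique:
  assumes "f \<in> dirichlet_D0" "g \<in> dirichlet_D0" "h \<in> dirichlet_D0"
    and "solves_ds_equation f w g" "solves_ds_equation f w h"
  shows "g = h"
proof -
  obtain \<sigma>f where \<sigma>f: "\<And>s. Re s \<ge> \<sigma>f \<Longrightarrow> ds_abs_conv f s" using dirichlet_D0_abs_conv[OF assms(1)] by blast
  obtain \<sigma>g where \<sigma>g: "\<And>s. Re s \<ge> \<sigma>g \<Longrightarrow> ds_abs_conv g s" using dirichlet_D0_abs_conv[OF assms(2)] by blast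
  obtain \<sigma>h where \<sigma>h: "\<And>s. Re s \<ge> \<sigma>h \<Longrightarrow> ds_abs_conv h s" using dirichlet_D0_abs_conv[OF assms(3)] by blast
  obtain \<theta>g where \<theta>g: "\<And>s. Re s > \<theta>g \<Longrightarrow> ds_eval f (s - w * ds_eval g s) = ds_eval g s"
    using assms(4) by (auto simp: solves_ds_equation_def half_plane_def)
  obtain \<theta>h where \<theta>h: "\<And>s. Re s > \<theta>h \<Longrightarrow> ds_eval f (s - w * ds_eval h s) = ds_eval h s"
    using assms(5) by (auto simp: solves_ds_equation_def half_plane_def)
  \<comment> \<open>The bound 1/(|w| + 1) forces |w| L < 1 and also makes sense for w = 0.\<close>
  obtain \<tau> where \<tau>: "\<tau> \<ge> \<sigma>f" "ds_norm f \<tau> < 1 / (norm w + 1)"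
    using ds_norm_eventually_small[of f \<sigma>f "1 / (norm w + 1)"] \<sigma>f dirichlet_D0_D[OF assms(1)]
    by (auto simp: add_nonneg_pos)
  \<comment> \<open>The last two entries keep s - w g(s) and s - w h(s) in the region Re >= \<tau> +
    1, where the Lipschitz bound for f holds.\<close>
  define R where "R = {\<sigma>g, \<sigma>h, \<theta>g + 1, \<theta>h + 1,
    \<tau> + 1 + norm w * ds_norm g \<sigma>g, \<tau> + 1 + norm w * ds_norm h \<sigma>h}"
  define \<rho> where "\<rho> = Max R"
  have \<rho>_ge: "r \<le> \<rho>" if "r \<in> R" for r
    using that unfolding \<rho>_def by (intro Max_ge) (simp_all add: R_def)
  have eq: "ds_eval g s = ds_eval h s" if "Re s \<ge> \<rho>" for s
  proof -
    have s: "Re s \<ge> \<sigma>g" "Re s \<ge> \<sigma>h" "Re s > \<theta>g" "Re s > \<theta>h"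
      "Re s \<ge> \<tau> + 1 + norm w * ds_norm g \<sigma>g" "Re s \<ge> \<tau> + 1 + norm w * ds_norm h \<sigma>h"
      using that \<rho>_ge[of "\<sigma>g"] \<rho>_ge[of "\<sigma>h"] \<rho>_ge[of "\<theta>g + 1"] \<rho>_ge[of "\<theta>h + 1"]
        \<rho>_ge[of "\<tau> + 1 + norm w * ds_norm g \<sigma>g"] \<rho>_ge[of "\<tau> + 1 + norm w * ds_norm h \<sigma>h"]
      by (simp_all add: R_def)
    have Re_ge: "Re (s - w * z) \<ge> \<tau> + 1" if "norm z \<le> K" "Re s \<ge> \<tau> + 1 + norm w * K" for z K
    proof -
      have "Re (w * z) \<le> norm w * norm z" using complex_Re_le_cmod[of "w * z"] by (simp add: norm_mult)
      also have "\<dots> \<le> norm w * K" using that(1) by (intro mult_left_mono) auto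
      finally show ?thesis using that(2) by simp
    qed
    have "norm (ds_eval g s) \<le> ds_norm g \<sigma>g"
      using norm_ds_eval_le[OF \<sigma>g[OF s(1)]] ds_norm_antimono[OF \<sigma>g, of "of_real \<sigma>g" "Re s"] s(1) by simp
    then have g: "Re (s - w * ds_eval g s) \<ge> \<tau> + 1" using s(5) by (rule Re_ge)
    have "norm (ds_eval h s) \<le> ds_norm h \<sigma>h"
      using norm_ds_eval_le[OF \<sigma>h[OF s(2)]] ds_norm_antimono[OF \<sigma>h, of "of_real \<sigma>h" "Re s"] s(2) by simp
    then have h: "Re (s - w * ds_eval h s) \<ge> \<tau> + 1" using s(6) by (rule Re_ge)
    define \<Delta> where "\<Delta> = norm (ds_eval g s - ds_eval h s)"
    have "\<Delta> = norm (ds_eval f (s - w * ds_eval g s) - ds_eval f (s - w * ds_eval h s))"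
      using \<theta>g[OF s(3)] \<theta>h[OF s(4)] by (simp add: \<Delta>_def)
    also have "\<dots> \<le> ds_norm f \<tau> * norm ((s - w * ds_eval g s) - (s - w * ds_eval h s))"
      using \<sigma>f \<tau>(1) g h by (intro ds_eval_lipschitz) auto
    also have "(s - w * ds_eval g s) - (s - w * ds_eval h s) = - (w * (ds_eval g s - ds_eval h s))"
      by (simp add: algebra_simps)
    finally have "\<Delta> \<le> ds_norm f \<tau> * norm w * \<Delta>" by (simp add: norm_mult \<Delta>_def)
    moreover have "ds_norm f \<tau> * norm w < 1"
    proof -
      have "ds_norm f \<tau> * norm w \<le> ds_norm f \<tau> * (norm w + 1)"
        by (intro mult_left_mono ds_norm_nonneg) simp
      also have "\<dots> < 1"
        using \<tau>(2) pos_less_divide_eq[of "norm w + 1" "ds_norm f \<tau>" 1] by (simp add: add_nonneg_pos)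
      finally show ?thesis .
    qed
    ultimately have "\<Delta> \<le> 0"
      using mult_strict_right_mono[of "ds_norm f \<tau> * norm w" 1 \<Delta>] by (cases "\<Delta> > 0") auto
    then show ?thesis by (simp add: \<Delta>_def)
  qed
  have "g n = h n" if "n \<ge> 1" for n
    using \<sigma>g \<sigma>h eq that
    by (intro ds_coeffs_unique[of "max \<rho> (max \<sigma>g \<sigma>h)" g h n]) auto
  moreover have "g 0 = h 0" using assms(2,3) by (simp add: dirichlet_D0_D)
  ultimately show ?thesis by (metis ext less_one linorder_not_le)
qed

text \<open>The half-plane in \<open>generated_by\<close> may depend on x, so coefficients are
  compared for each x separately.\<close>

lemma generated_by_eq_dexp_poly:
  assumes "f \<in> dirichlet_D0" "generated_by \<alpha> f" "n \<ge> 1"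
  shows "\<alpha> n = dexp_poly f n"
proof (rule poly_ext)
  fix x
  obtain \<sigma> where \<sigma>: "\<And>s. Re s \<ge> \<sigma> \<Longrightarrow> ds_abs_conv f s" using dirichlet_D0_abs_conv[OF assms(1)] by blast
  obtain \<theta> where \<theta>: "\<And>s. Re s > \<theta> \<Longrightarrow> ds_abs_conv (\<lambda>n. poly (\<alpha> n) x) s"
    "\<And>s. Re s > \<theta> \<Longrightarrow> exp (x * ds_eval f s) = ds_eval (\<lambda>n. poly (\<alpha> n) x) s"
    using assms(2) unfolding generated_by_def half_plane_def by blast
  have f1: "f 1 = 0" by (rule dirichlet_D0_D[OF assms(1)])
  show "poly (\<alpha> n) x = poly (dexp_poly f n) x"
  proof (rule ds_coeffs_unique[where \<sigma> = "max \<sigma> (\<theta> + 1)" and a = "\<lambda>n. poly (\<alpha> n) x", OF _ _ _ assms(3)])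
    fix s assume "Re s \<ge> max \<sigma> (\<theta> + 1)"
    then have s: "ds_abs_conv f s" "Re s > \<theta>" using \<sigma> by auto
    show "ds_abs_conv (\<lambda>n. poly (\<alpha> n) x) s" using \<theta>(1) s(2) .
    show "ds_abs_conv (\<lambda>n. poly (dexp_poly f n) x) s" using s(1) f1 by (rule ds_abs_conv_dexp)
    show "ds_eval (\<lambda>n. poly (\<alpha> n) x) s = ds_eval (\<lambda>n. poly (dexp_poly f n) x) s"
      using \<theta>(2)[OF s(2)] ds_eval_dexp[where c = f, OF s(1) f1] by simp
  qed
qed

lemma infsum_from_2:
  fixes c :: "nat \<Rightarrow> complex"
  shows "(\<Sum>\<^sub>\<infinity>n\<in>{2..}. c n / of_nat n powr s) = ds_eval (\<lambda>n. if n \<ge> 2 then c n else 0) s"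
    and "ds_abs_conv (\<lambda>n. if n \<ge> 2 then c n else 0) s
      \<longleftrightarrow> (\<lambda>n. norm (c n / of_nat n powr s)) summable_on {2..}"
  unfolding ds_eval_def ds_abs_conv_def
  by (rule infsum_cong_neutral summable_on_cong_neutral; auto)+

theorem theorem2:
  fixes f :: "nat \<Rightarrow> complex" and w :: complex
  assumes "f \<in> dirichlet_D0"
  shows "(\<exists>!g. g \<in> dirichlet_D0 \<and> solves_ds_equation f w g) \<and>
    (\<forall>\<alpha> g. dirichlet_convolution_polys \<alpha> \<longrightarrow> generated_by \<alpha> f \<longrightarrow>
       g \<in> dirichlet_D0 \<longrightarrow> solves_ds_equation f w g \<longrightarrow>
       (\<exists>\<theta>. \<forall>s\<in>half_plane \<theta>.
          (\<lambda>n. norm (poly (hat_poly (\<alpha> n)) (w * of_real (ln (real n))) / of_nat n powr s))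
            summable_on {2..} \<and>
          ds_eval g s =
            (\<Sum>\<^sub>\<infinity>n\<in>{2..}. poly (hat_poly (\<alpha> n)) (w * of_real (ln (real n))) / of_nat n powr s) \<and>
          (\<forall>x.
            (\<lambda>n. norm (poly (hat_poly (\<alpha> n)) (x + w * of_real (ln (real n))) / of_nat n powr s))
              summable_on {2..} \<and>
            exp (x * ds_eval g s) =
              1 + x * (\<Sum>\<^sub>\<infinity>n\<in>{2..}.
                poly (hat_poly (\<alpha> n)) (x + w * of_real (ln (real n))) / of_nat n powr s))))"
proof (intro conjI allI impI)
  define g where "g = lag_coeff f w"
  have gD: "g \<in> dirichlet_D0" and sol: "solves_ds_equation f w g"
    using assms by (simp_all add: g_def lag_coeff_D0 lag_coeff_solves)
  show "\<exists>!g. g \<in> dirichlet_D0 \<and> solves_ds_equation f w g"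
    using gD sol solution_unique[OF assms] by blast
  fix \<alpha> g' assume \<alpha>: "generated_by \<alpha> f" and "g' \<in> dirichlet_D0" "solves_ds_equation f w g'"
  then have g': "g' = g" using solution_unique[OF assms] gD sol by blast
  have f1: "f 1 = 0" by (rule dirichlet_D0_D[OF assms])
  obtain \<sigma> where \<sigma>: "\<And>s. Re s \<ge> \<sigma> \<Longrightarrow> ds_abs_conv f s" using dirichlet_D0_abs_conv[OF assms] by blast
  \<comment> \<open>The threshold of \<open>hat_dexp_abs_conv\<close>, which is the same for every
    x.\<close>
  define \<theta> where "\<theta> = \<sigma> + norm w * ds_norm f \<sigma> + 1"
  define c where "c x n = (if n \<ge> 2 then poly (hat_poly (\<alpha> n)) (x + w * of_real (ln (real n))) else 0)"
    for x and n :: nat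
  have c: "c x = (\<lambda>n. if n \<ge> 2 then poly (hat_poly (dexp_poly f n)) (x + w * of_real (ln (real n))) else 0)"
    for x using generated_by_eq_dexp_poly[OF assms \<alpha>] by (auto simp: c_def)
  have c0: "c 0 = g" by (auto simp: c g_def lag_coeff_def)
  have conv: "ds_abs_conv (c x) s" if "s \<in> half_plane \<theta>" for x s
    unfolding c using that \<sigma> by (intro hat_dexp_abs_conv[of f "of_real \<sigma>"]) (auto simp: half_plane_def \<theta>_def)
  have exp: "exp (x * ds_eval g s) = 1 + x * ds_eval (c x) s" if "s \<in> half_plane \<theta>" for x s
  proof -
    have gs: "ds_abs_conv g s" using conv[OF that, of 0] by (simp add: c0)
    have g1: "g 1 = 0" by (rule dirichlet_D0_D[OF gD])
    \<comment> \<open>From index 2 on, the coefficients of exp (x g(s)) are x times those of the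
      displayed series; index 1 contributes the summand 1.\<close>
    have E: "poly (dexp_poly g n) x = x * c x n" if "n \<ge> 2" for n
      using lag_poly_eq_dexp_poly[where f = f, OF f1, of n w] poly_lag_poly[of n f w x] that by (simp add: c g_def)
    have "exp (x * ds_eval g s) = (\<Sum>\<^sub>\<infinity>n\<in>insert 1 {2..}. poly (dexp_poly g n) x / of_nat n powr s)"
    proof -
      have "{1..} = insert 1 {2::nat..}" by auto
      then show ?thesis using ds_eval_dexp[where c = g, OF gs g1, of x] by (simp only: ds_eval_def)
    qed
    also have "\<dots> = 1 + (\<Sum>\<^sub>\<infinity>n\<in>{2..}. poly (dexp_poly g n) x / of_nat n powr s)"
      using ds_abs_conv_summable[OF ds_abs_conv_dexp[where c = g, OF gs g1, of x]] dexp_poly_1[where c = g, OF g1]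
      by (subst infsum_insert) (auto intro: summable_on_subset_banach)
    also have "(\<Sum>\<^sub>\<infinity>n\<in>{2..}. poly (dexp_poly g n) x / of_nat n powr s)
        = (\<Sum>\<^sub>\<infinity>n\<in>{2..}. x * (c x n / of_nat n powr s))"
      by (intro infsum_cong) (simp add: E)
    also have "\<dots> = x * ds_eval (\<lambda>n. if n \<ge> 2 then c x n else 0) s"
      unfolding infsum_cmult_right' infsum_from_2(1)[of "c x"] ..
    also have "(\<lambda>n. if n \<ge> 2 then c x n else 0) = c x" by (auto simp: c_def)
    finally show ?thesis .
  qed
  show "\<exists>\<theta>. \<forall>s\<in>half_plane \<theta>.
          (\<lambda>n. norm (poly (hat_poly (\<alpha> n)) (w * of_real (ln (real n))) / of_nat n powr s))
            summable_on {2..} \<and>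
          ds_eval g' s =
            (\<Sum>\<^sub>\<infinity>n\<in>{2..}. poly (hat_poly (\<alpha> n)) (w * of_real (ln (real n))) / of_nat n powr s) \<and>
          (\<forall>x.
            (\<lambda>n. norm (poly (hat_poly (\<alpha> n)) (x + w * of_real (ln (real n))) / of_nat n powr s))
              summable_on {2..} \<and>
            exp (x * ds_eval g' s) =
              1 + x * (\<Sum>\<^sub>\<infinity>n\<in>{2..}.
                poly (hat_poly (\<alpha> n)) (x + w * of_real (ln (real n))) / of_nat n powr s))"
  proof (intro exI[of _ \<theta>] ballI)
    fix s assume s: "s \<in> half_plane \<theta>"
    have A: "(\<lambda>n. norm (poly (hat_poly (\<alpha> n)) (x + w * of_real (ln (real n))) / of_nat n powr s))
        summable_on {2..}" for x
      using conv[OF s, of x] unfolding c_def infsum_from_2(2) .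
    have B: "(\<Sum>\<^sub>\<infinity>n\<in>{2..}. poly (hat_poly (\<alpha> n)) (x + w * of_real (ln (real n))) / of_nat n powr s)
        = ds_eval (c x) s" for x
      unfolding c_def by (rule infsum_from_2(1))
    show "(\<lambda>n. norm (poly (hat_poly (\<alpha> n)) (w * of_real (ln (real n))) / of_nat n powr s))
            summable_on {2..} \<and>
          ds_eval g' s =
            (\<Sum>\<^sub>\<infinity>n\<in>{2..}. poly (hat_poly (\<alpha> n)) (w * of_real (ln (real n))) / of_nat n powr s) \<and>
          (\<forall>x.
            (\<lambda>n. norm (poly (hat_poly (\<alpha> n)) (x + w * of_real (ln (real n))) / of_nat n powr s))
              summable_on {2..} \<and>
            exp (x * ds_eval g' s) =
              1 + x * (\<Sum>\<^sub>\<infinity>n\<in>{2..}.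
                poly (hat_poly (\<alpha> n)) (x + w * of_real (ln (real n))) / of_nat n powr s))"
    proof -
      have "(\<Sum>\<^sub>\<infinity>n\<in>{2..}. poly (hat_poly (\<alpha> n)) (w * of_real (ln (real n))) / of_nat n powr s) = ds_eval g s"
        using B[of 0] by (simp add: c0)
      then show ?thesis using A A[of 0] exp[OF s] unfolding B g' by simp
    qed
  qed
qed

end
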